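(* Let $F$ be any field and let $D$ be a central $F$-division algebra of degree $d>2$. Let $K|F$ be a splitting field of $D$ and consider $\mathrm{SL}_1(D)\le\mathrm{SL}_d(K)$. Let $\Delta$ be the standard spherical building associated to $\mathrm{SL}_d(K)$ and, if $K$ is complete with respect to a discrete valuation, let $\Delta_a$ be the standard affine building associated to $\mathrm{SL}_d(K)$. Then the action of $\mathrm{SL}_1(D)$ on $\Delta$, and (if $K$ is complete with respect to a discrete valuation) its action on $\Delta_a$, is not weakly transitive, and thus is not strongly transitive with respect to any apartment system.
   Context: A division algebra $D$ with center $F$ has degree $d$ if $\dim_F(D)=d^2$. A splitting field of $D$ is a field extension $K|F$ with $D\otimes_F K\cong M_d(K)$; $D$ is identified with a subalgebra of $M_d(K)$ via the resulting embedding $D\hookrightarrow D\otimes_F K\cong M_d(K)$. $\mathrm{SL}_1(D)$ is the group of elements of $D$ of reduced norm $1$, i.e. those whose image in $M_d(K)$ has determinant $1$. The standard spherical building $\Delta$ of $\mathrm{SL}_d(K)$ is the flag complex of proper nonzero subspaces of $K^d$, with apartments given by frames (decompositions of $K^d$ into $d$ lines). When $K$ is complete with respect to a discrete valuation with valuation ring $R$, the standard affine building $\Delta_a$ is the Bruhat–Tits building of $\mathrm{SL}_d(K)$, whose vertices are homothety classes of $R$-lattices in $K^d$; apartments of its complete apartment system correspond to frames of $K^d$. Let a group $H$ act on a building by type-preserving automorphisms. The action is weakly transitive if there exists an apartment $\Sigma$ in the complete apartment system such that $\mathrm{Stab}_H(\Sigma)$ acts transitively on the set of chambers of $\Sigma$.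 A chamber-transitive action is strongly transitive with respect to an $H$-invariant apartment system $\mathcal{A}$ if $H$ is transitive on $\mathcal{A}$ and there exists $\Sigma\in\mathcal{A}$ such that $\mathrm{Stab}_H(\Sigma)$ acts transitively on the set of chambers of $\Sigma$. *)

theory Defs
  imports
    "HOL-Algebra.Free_Abelian_Groups"
    "HOL-Algebra.QuotRing"
    "Jordan_Normal_Form.VS_Connect"
    "Jordan_Normal_Form.Determinant"
begin

section \<open>Central division algebras and splitting fields\<close>

text \<open>Fields and division rings are types; the structure map \<open>\<iota>\<close> makes \<open>'d\<close> an algebra over
  \<open>'f\<close>. A \<open>'f\<close>-space of infinite dimension has \<open>dim = 0\<close>, so for \<open>n > 0\<close> the equation for the
  dimension below includes finite-dimensionality.\<close>

definition central_division_algebra :: "('f::field \<Rightarrow> 'd::division_ring) \<Rightarrow> nat \<Rightarrow> bool" where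
  "central_division_algebra \<iota> n \<longleftrightarrow>
     Ring_Hom.ring_hom \<iota> \<and>
     range \<iota> = {z. \<forall>x. z * x = x * z} \<and>
     vector_space.dim (\<lambda>a x. \<iota> a * x) (UNIV :: 'd set) = n\<^sup>2"

text \<open>The tensor product over \<open>'f\<close> of \<open>'d\<close> and \<open>'k\<close> is the free abelian group on \<open>'d \<times> 'k\<close>
  modulo the usual bilinear and balancing relators. The free abelian group, with the
  multiplication extended biadditively from \<open>(x, c)(y, e) = (xy, ce)\<close>, is the monoid ring of
  \<open>'d \<times> 'k\<close>, so that the tensor product with its ring structure is a quotient of this ring.\<close>

definition pair_ring :: "('d::ring_1 \<times> 'k::ring_1 \<Rightarrow>\<^sub>0 int) ring" where
  "pair_ring =
     \<lparr>carrier = UNIV,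
      mult = (\<lambda>p q. frag_extend (\<lambda>(x, c). frag_extend (\<lambda>(y, e). frag_of (x * y, c * e)) q) p),
      one = frag_of (1, 1), zero = 0, add = (+)\<rparr>"

definition tensor_relators ::
  "('f \<Rightarrow> 'd::ring_1) \<Rightarrow> ('f \<Rightarrow> 'k::ring_1) \<Rightarrow> ('d \<times> 'k \<Rightarrow>\<^sub>0 int) set" where
  "tensor_relators \<iota>D \<iota>K =
     {frag_of (x + y, c) - (frag_of (x, c) + frag_of (y, c)) | x y c. True} \<union>
     {frag_of (x, c + e) - (frag_of (x, c) + frag_of (x, e)) | x c e. True} \<union>
     {frag_of (x * \<iota>D a, c) - frag_of (x, \<iota>K a * c) | x a c. True}"

definition tensor_ideal ::
  "('f \<Rightarrow> 'd::ring_1) \<Rightarrow> ('f \<Rightarrow> 'k::ring_1) \<Rightarrow> ('d \<times> 'k \<Rightarrow>\<^sub>0 int) set" where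
  "tensor_ideal \<iota>D \<iota>K = genideal pair_ring (tensor_relators \<iota>D \<iota>K)"

definition tensor_ring ::
  "('f \<Rightarrow> 'd::ring_1) \<Rightarrow> ('f \<Rightarrow> 'k::ring_1) \<Rightarrow> ('d \<times> 'k \<Rightarrow>\<^sub>0 int) set ring" where
  "tensor_ring \<iota>D \<iota>K = pair_ring Quot (tensor_ideal \<iota>D \<iota>K)"

definition pure_tensor ::
  "('f \<Rightarrow> 'd::ring_1) \<Rightarrow> ('f \<Rightarrow> 'k::ring_1) \<Rightarrow> 'd \<Rightarrow> 'k \<Rightarrow> ('d \<times> 'k \<Rightarrow>\<^sub>0 int) set" where
  "pure_tensor \<iota>D \<iota>K x c = a_r_coset pair_ring (tensor_ideal \<iota>D \<iota>K) (frag_of (x, c))"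

text \<open>\<open>\<Theta>\<close> is an isomorphism of \<open>'k\<close>-algebras from the tensor product onto the matrix algebra; for
  a ring isomorphism, \<open>'k\<close>-linearity amounts to the condition on the tensors \<open>1 \<otimes> c\<close>.\<close>

definition splitting_iso ::
  "('f::field \<Rightarrow> 'd::division_ring) \<Rightarrow> ('f \<Rightarrow> 'k::field) \<Rightarrow> nat
    \<Rightarrow> (('d \<times> 'k \<Rightarrow>\<^sub>0 int) set \<Rightarrow> 'k mat) \<Rightarrow> bool" where
  "splitting_iso \<iota>D \<iota>K n \<Theta> \<longleftrightarrow>
     \<Theta> \<in> ring_iso (tensor_ring \<iota>D \<iota>K) (ring_mat TYPE('k) n ()) \<and>
     (\<forall>c. \<Theta> (pure_tensor \<iota>D \<iota>K 1 c) = c \<cdot>\<^sub>m 1\<^sub>m n)"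

definition splitting_embedding ::
  "('f::field \<Rightarrow> 'd::division_ring) \<Rightarrow> ('f \<Rightarrow> 'k::field)
    \<Rightarrow> (('d \<times> 'k \<Rightarrow>\<^sub>0 int) set \<Rightarrow> 'k mat) \<Rightarrow> 'd \<Rightarrow> 'k mat" where
  "splitting_embedding \<iota>D \<iota>K \<Theta> x = \<Theta> (pure_tensor \<iota>D \<iota>K x 1)"

definition SL1 :: "('d \<Rightarrow> 'k::field mat) \<Rightarrow> 'k mat set" where
  "SL1 \<phi> = {\<phi> x | x. det (\<phi> x) = 1}"


section \<open>Group actions on simplicial complexes with apartments\<close>

text \<open>A simplicial complex is the set of its simplices, the empty simplex included. A group \<open>H\<close>
  acts through a map \<open>act\<close> giving the action of each of its elements on vertices.\<close>

definition flag_complex :: "'v set \<Rightarrow> ('v \<Rightarrow> 'v \<Rightarrow> bool) \<Rightarrow> 'v set set" where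
  "flag_complex V inc = {\<sigma>. finite \<sigma> \<and> \<sigma> \<subseteq> V \<and> (\<forall>x\<in>\<sigma>. \<forall>y\<in>\<sigma>. inc x y)}"

definition chambers :: "'v set set \<Rightarrow> 'v set set" where
  "chambers \<Delta> = {C \<in> \<Delta>. \<forall>\<sigma>\<in>\<Delta>. C \<subseteq> \<sigma> \<longrightarrow> \<sigma> = C}"

definition complex_image :: "('v \<Rightarrow> 'v) \<Rightarrow> 'v set set \<Rightarrow> 'v set set" where
  "complex_image f \<Sigma> = (\<lambda>\<sigma>. f ` \<sigma>) ` \<Sigma>"

definition stabilizer :: "('g \<Rightarrow> 'v \<Rightarrow> 'v) \<Rightarrow> 'g set \<Rightarrow> 'v set set \<Rightarrow> 'g set" where
  "stabilizer act H \<Sigma> = {h \<in> H. complex_image (act h) \<Sigma> = \<Sigma>}"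

definition chamber_transitive :: "('g \<Rightarrow> 'v \<Rightarrow> 'v) \<Rightarrow> 'g set \<Rightarrow> 'v set set \<Rightarrow> bool" where
  "chamber_transitive act H \<Delta> \<longleftrightarrow>
     (\<forall>C\<in>chambers \<Delta>. \<forall>C'\<in>chambers \<Delta>. \<exists>h\<in>H. act h ` C = C')"

definition weakly_transitive ::
  "('g \<Rightarrow> 'v \<Rightarrow> 'v) \<Rightarrow> 'g set \<Rightarrow> 'v set set set \<Rightarrow> bool" where
  "weakly_transitive act H \<A>c \<longleftrightarrow>
     (\<exists>\<Sigma>\<in>\<A>c. chamber_transitive act (stabilizer act H \<Sigma>) \<Sigma>)"

text \<open>The complete apartment system \<open>\<A>c\<close> contains every other apartment system by definition. The
  building axioms other than the one stated below (every apartment is a Coxeter complex; two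
  apartments with common simplices are isomorphic by an isomorphism fixing these) pass to every
  subset of \<open>\<A>c\<close>.\<close>

definition apartment_system :: "'v set set \<Rightarrow> 'v set set set \<Rightarrow> 'v set set set \<Rightarrow> bool" where
  "apartment_system \<Delta> \<A>c \<A> \<longleftrightarrow>
     \<A> \<subseteq> \<A>c \<and> (\<forall>\<sigma>\<in>\<Delta>. \<forall>\<tau>\<in>\<Delta>. \<exists>\<Sigma>\<in>\<A>. \<sigma> \<in> \<Sigma> \<and> \<tau> \<in> \<Sigma>)"

definition strongly_transitive ::
  "('g \<Rightarrow> 'v \<Rightarrow> 'v) \<Rightarrow> 'g set \<Rightarrow> 'v set set \<Rightarrow> 'v set set set \<Rightarrow> bool" where
  "strongly_transitive act H \<Delta> \<A> \<longleftrightarrow>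
     chamber_transitive act H \<Delta> \<and>
     (\<forall>h\<in>H. \<forall>\<Sigma>\<in>\<A>. complex_image (act h) \<Sigma> \<in> \<A>) \<and>
     (\<forall>\<Sigma>\<in>\<A>. \<forall>\<Sigma>'\<in>\<A>. \<exists>h\<in>H. complex_image (act h) \<Sigma> = \<Sigma>') \<and>
     (\<exists>\<Sigma>\<in>\<A>. chamber_transitive act (stabilizer act H \<Sigma>) \<Sigma>)"


section \<open>The spherical building of the special linear group\<close>

abbreviation vec_sp :: "nat \<Rightarrow> ('k::field, 'k vec) module" where
  "vec_sp n \<equiv> module_vec TYPE('k) n"

definition proper_subspaces :: "nat \<Rightarrow> 'k::field vec set set" where
  "proper_subspaces n =
     {W. subspace class_ring W (vec_sp n) \<and> W \<noteq> {0\<^sub>v n} \<and> W \<noteq> carrier_vec n}"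

definition spherical_building :: "nat \<Rightarrow> 'k::field vec set set set" where
  "spherical_building n = flag_complex (proper_subspaces n) (\<lambda>U W. U \<subseteq> W \<or> W \<subseteq> U)"

definition basis_lines :: "nat \<Rightarrow> 'k::field vec set \<Rightarrow> 'k vec set set" where
  "basis_lines n B = (\<lambda>b. LinearCombinations.module.span class_ring (vec_sp n) {b}) ` B"

definition frames :: "nat \<Rightarrow> 'k::field vec set set set" where
  "frames n = {basis_lines n B | B. vectorspace.basis class_ring (vec_sp n) B}"

definition spherical_apartment :: "nat \<Rightarrow> 'k::field vec set set \<Rightarrow> 'k vec set set set" where
  "spherical_apartment n \<F> =
     {\<sigma> \<in> spherical_building n.
        \<forall>W\<in>\<sigma>. \<exists>\<M>\<subseteq>\<F>. W = LinearCombinations.module.span class_ring (vec_sp n) (\<Union>\<M>)}"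

definition spherical_apartments :: "nat \<Rightarrow> 'k::field vec set set set set" where
  "spherical_apartments n = spherical_apartment n ` frames n"

definition mat_image :: "'k::field mat \<Rightarrow> 'k vec set \<Rightarrow> 'k vec set" where
  "mat_image g W = (\<lambda>w. g *\<^sub>v w) ` W"


section \<open>The affine building of the special linear group\<close>

text \<open>A discrete valuation is normalised to have value group \<open>\<int>\<close>. The value \<open>v 0\<close>, which should be
  \<open>\<infinity>\<close>, is left unspecified and never used.\<close>

definition discrete_valuation :: "('k::field \<Rightarrow> int) \<Rightarrow> bool" where
  "discrete_valuation v \<longleftrightarrow>
     (\<forall>x y. x \<noteq> 0 \<longrightarrow> y \<noteq> 0 \<longrightarrow> v (x * y) = v x + v y) \<and>
     (\<forall>x y. x \<noteq> 0 \<longrightarrow> y \<noteq> 0 \<longrightarrow> x + y \<noteq> 0 \<longrightarrow> min (v x) (v y) \<le> v (x + y)) \<and>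
     v ` (UNIV - {0}) = UNIV"

definition val_ball :: "('k::field \<Rightarrow> int) \<Rightarrow> int \<Rightarrow> 'k set" where
  "val_ball v m = {x. x = 0 \<or> m \<le> v x}"

definition val_complete :: "('k::field \<Rightarrow> int) \<Rightarrow> bool" where
  "val_complete v \<longleftrightarrow>
     (\<forall>X :: nat \<Rightarrow> 'k.
        (\<forall>m. \<exists>N. \<forall>i\<ge>N. \<forall>j\<ge>N. X i - X j \<in> val_ball v m) \<longrightarrow>
        (\<exists>l. \<forall>m. \<exists>N. \<forall>i\<ge>N. X i - l \<in> val_ball v m))"

abbreviation valuation_ring :: "('k::field \<Rightarrow> int) \<Rightarrow> 'k set" where
  "valuation_ring v \<equiv> val_ball v 0"

definition lattice_span :: "('k::field \<Rightarrow> int) \<Rightarrow> nat \<Rightarrow> 'k vec set \<Rightarrow> 'k vec set" where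
  "lattice_span v n B =
     {LinearCombinations.module.lincomb (vec_sp n) a B | a. a ` B \<subseteq> valuation_ring v}"

definition homothety_class :: "'k::field vec set \<Rightarrow> 'k vec set set" where
  "homothety_class L = {(\<lambda>w. c \<cdot>\<^sub>v w) ` L | c. c \<noteq> 0}"

definition lattice_vertices :: "('k::field \<Rightarrow> int) \<Rightarrow> nat \<Rightarrow> 'k vec set set set" where
  "lattice_vertices v n =
     {homothety_class (lattice_span v n B) | B. vectorspace.basis class_ring (vec_sp n) B}"

definition lattice_incident ::
  "('k::field \<Rightarrow> int) \<Rightarrow> 'k vec set set \<Rightarrow> 'k vec set set \<Rightarrow> bool" where
  "lattice_incident v \<Lambda> \<Lambda>' \<longleftrightarrow>
     (\<exists>L\<in>\<Lambda>. \<exists>L'\<in>\<Lambda>'. \<exists>\<pi>. \<pi> \<noteq> 0 \<and> v \<pi> = 1 \<and> (\<lambda>w. \<pi> \<cdot>\<^sub>v w) ` L \<subseteq> L' \<and> L' \<subseteq> L)"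

definition affine_building :: "('k::field \<Rightarrow> int) \<Rightarrow> nat \<Rightarrow> 'k vec set set set set" where
  "affine_building v n = flag_complex (lattice_vertices v n) (lattice_incident v)"

text \<open>The apartment of a frame is spanned by the classes of the lattices having a basis of vectors
  on the lines of the frame.\<close>

definition affine_apartment ::
  "('k::field \<Rightarrow> int) \<Rightarrow> nat \<Rightarrow> 'k vec set set \<Rightarrow> 'k vec set set set set" where
  "affine_apartment v n \<F> =
     {\<sigma> \<in> affine_building v n.
        \<forall>\<Lambda>\<in>\<sigma>. \<exists>B. vectorspace.basis class_ring (vec_sp n) B \<and> basis_lines n B = \<F> \<and>
                 \<Lambda> = homothety_class (lattice_span v n B)}"

text \<open>Only for complete \<open>v\<close> do the apartments of all frames form the complete apartment system of
  the affine building; in general the latter is larger.\<close>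

definition affine_apartments ::
  "('k::field \<Rightarrow> int) \<Rightarrow> nat \<Rightarrow> 'k vec set set set set set" where
  "affine_apartments v n = affine_apartment v n ` frames n"

definition class_image :: "'k::field mat \<Rightarrow> 'k vec set set \<Rightarrow> 'k vec set set" where
  "class_image g \<Lambda> = mat_image g ` \<Lambda>"

end

theory Submission
  imports Defs "Jordan_Normal_Form.DL_Rank"
begin

text \<open>
  The obstruction is that an element of a division algebra \<open>D\<close> acting on \<open>K\<^sup>d\<close> is determined by its
  value at a single nonzero vector: the difference of two elements of \<open>D\<close> is zero or invertible, so
  it is zero as soon as it kills a nonzero vector (\<open>eq_if_agree_on_vector\<close>). In particular, two
  elements of \<open>D\<close> having a common eigenvector commute.

  Suppose that the stabiliser in \<open>SL\<^sub>1(D)\<close> of the apartment of a frame is transitive on the chambers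
  of this apartment, and let \<open>b\<^sub>0, \<dots>, b\<^sub>d\<^sub>-\<^sub>1\<close> be vectors spanning the lines of the frame. The
  stabiliser permutes the lines of the frame, so that it consists of monomial matrices with respect
  to this basis. An ordering of the basis gives a chamber of the apartment: the flag of spans of
  initial segments in the spherical case, and the chain of lattices obtained from the lattice with
  basis \<open>b\<^sub>0, \<dots>, b\<^sub>d\<^sub>-\<^sub>1\<close> by multiplying initial segments by a uniformiser in the affine case. Elements of
  determinant \<open>1\<close> preserve types, and so transitivity on these chambers means that every permutation
  of the basis is induced by a monomial element of \<open>SL\<^sub>1(D)\<close>
  (\<open>spherical_weakly_transitive_realises_all_permutations\<close>,
  \<open>affine_weakly_transitive_realises_all_permutations\<close>).

  This is impossible for \<open>d > 2\<close> (\<open>not_all_permutations_realised\<close>). Let \<open>x\<close> and \<open>y\<close> be elements of \<open>D\<close>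
  inducing the transpositions \<open>(0 1)\<close> and \<open>(1 2)\<close>. If \<open>d \<ge> 4\<close>, then \<open>b\<^sub>3\<close> is a common eigenvector, so
  \<open>x\<close> and \<open>y\<close> commute, whereas the transpositions do not. If \<open>d = 3\<close>, then \<open>x\<^sup>2\<close> and \<open>y\<close> have the common
  eigenvector \<open>b\<^sub>0\<close> and commute; as \<open>y\<close> exchanges the lines of \<open>b\<^sub>1\<close> and \<open>b\<^sub>2\<close>, the eigenvalues of \<open>x\<^sup>2\<close>
  on them agree. Together with \<open>det x = 1\<close> this forces \<open>x\<^sup>3 b\<^sub>2 = - b\<^sub>2\<close>, hence \<open>x\<^sup>3 = - 1\<close>, although \<open>x\<^sup>3\<close>
  exchanges the lines of \<open>b\<^sub>0\<close> and \<open>b\<^sub>1\<close>.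

  Strong transitivity with respect to an apartment system contains weak transitivity by definition,
  because the apartments of the system belong to the complete apartment system.
\<close>

section \<open>The representation of the algebra over a splitting field\<close>

text \<open>The identities of the monoid ring of \<open>'d \<times> 'k\<close> are identities between additive maps, so that
  it is enough to check them on generators.\<close>
lemma additive_eq_on_frag:
  fixes f g :: "('a \<Rightarrow>\<^sub>0 int) \<Rightarrow> ('b \<Rightarrow>\<^sub>0 int)"
  assumes "f 0 = g 0" "\<And>p q. f (p - q) = f p - f q" "\<And>p q. g (p - q) = g p - g q"
    and "\<And>x. f (frag_of x) = g (frag_of x)"
  shows "f p = g p"
  using subset_UNIV by (induction p rule: frag_induction) (simp_all add: assms)

lemma frag_extend_zero_fun: "frag_extend (\<lambda>x. 0) p = 0"
  by (simp add: frag_extend_eq_0)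

lemma frag_extend_diff_fun: "frag_extend (\<lambda>x. f x - g x) p = frag_extend f p - frag_extend g p"
  by (rule additive_eq_on_frag[where f = "frag_extend (\<lambda>x. f x - g x)"
        and g = "\<lambda>p. frag_extend f p - frag_extend g p"]) (simp_all add: frag_extend_diff)

lemma frag_extend_add_fun: "frag_extend (\<lambda>x. f x + g x) p = frag_extend f p + frag_extend g p"
  by (rule additive_eq_on_frag[where f = "frag_extend (\<lambda>x. f x + g x)"
        and g = "\<lambda>p. frag_extend f p + frag_extend g p"]) (simp_all add: frag_extend_diff)

abbreviation pair_mult :: "('d::ring_1 \<times> 'k::ring_1 \<Rightarrow>\<^sub>0 int) \<Rightarrow> ('d \<times> 'k \<Rightarrow>\<^sub>0 int) \<Rightarrow> ('d \<times> 'k \<Rightarrow>\<^sub>0 int)"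
  where "pair_mult \<equiv> Group.mult pair_ring"

lemma pair_ring_simps:
  "carrier pair_ring = UNIV" "one pair_ring = frag_of (1, 1)" "zero pair_ring = 0"
  "add pair_ring = (+)"
  by (simp_all add: pair_ring_def)

lemma pair_mult_frag_of: "pair_mult (frag_of (x, c)) (frag_of (y, e)) = frag_of (x * y, c * e)"
  by (simp add: pair_ring_def)

lemma pair_mult_distribs:
  "pair_mult 0 q = 0" "pair_mult p 0 = 0"
  "pair_mult (p - p') q = pair_mult p q - pair_mult p' q"
  "pair_mult p (q - q') = pair_mult p q - pair_mult p q'"
  "pair_mult (p + p') q = pair_mult p q + pair_mult p' q"
  "pair_mult p (q + q') = pair_mult p q + pair_mult p q'"
  by (simp_all add: pair_ring_def frag_extend_diff frag_extend_add frag_extend_zero_fun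
      frag_extend_diff_fun frag_extend_add_fun split_def)

lemma pair_mult_assoc: "pair_mult (pair_mult p q) r = pair_mult p (pair_mult q r)"
proof -
  have 1: "pair_mult (pair_mult (frag_of a) (frag_of b)) (frag_of c)
    = pair_mult (frag_of a) (pair_mult (frag_of b) (frag_of c))" for a b c :: "'a \<times> 'b"
    by (cases a; cases b; cases c) (simp add: pair_mult_frag_of mult.assoc)
  have 2: "pair_mult (pair_mult (frag_of a) (frag_of b)) r
    = pair_mult (frag_of a) (pair_mult (frag_of b) r)" for a b :: "'a \<times> 'b"
    by (rule additive_eq_on_frag[where p = r]) (simp_all add: pair_mult_distribs 1)
  have 3: "pair_mult (pair_mult (frag_of a) q) r
    = pair_mult (frag_of a) (pair_mult q r)" for a :: "'a \<times> 'b"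
    by (rule additive_eq_on_frag[where p = q]) (simp_all add: pair_mult_distribs 2)
  show ?thesis
    by (rule additive_eq_on_frag[where p = p]) (simp_all add: pair_mult_distribs 3)
qed

lemma pair_mult_one: "pair_mult (frag_of (1, 1)) p = p" "pair_mult p (frag_of (1, 1)) = p"
proof -
  show "pair_mult (frag_of (1, 1)) p = p"
    by (rule additive_eq_on_frag[where p = p])
      (simp_all add: pair_mult_distribs pair_mult_frag_of split_paired_all)
  show "pair_mult p (frag_of (1, 1)) = p"
    by (rule additive_eq_on_frag[where p = p])
      (simp_all add: pair_mult_distribs pair_mult_frag_of split_paired_all)
qed

lemma ring_pair_ring: "ring (pair_ring :: ('d::ring_1 \<times> 'k::ring_1 \<Rightarrow>\<^sub>0 int) ring)"
proof (rule ringI)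
  show "abelian_group (pair_ring :: ('d \<times> 'k \<Rightarrow>\<^sub>0 int) ring)"
    by (rule abelian_groupI) (auto simp: pair_ring_simps algebra_simps intro: exI[of _ "- _"])
  show "monoid (pair_ring :: ('d \<times> 'k \<Rightarrow>\<^sub>0 int) ring)"
    by (rule monoidI) (simp_all add: pair_ring_simps pair_mult_assoc pair_mult_one)
qed (simp_all add: pair_ring_simps pair_mult_distribs)

text \<open>The argument depends on the splitting only through the ring homomorphism
  \<open>x \<mapsto> \<Theta> (x \<otimes> 1)\<close> from the division algebra to the matrices.\<close>
locale division_algebra_rep =
  fixes \<phi> :: "'d::division_ring \<Rightarrow> 'k::field mat" and n :: nat
  assumes rep_closed [simp]: "\<phi> x \<in> carrier_mat n n"
    and rep_add: "\<phi> (x + y) = \<phi> x + \<phi> y"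
    and rep_mult: "\<phi> (x * y) = \<phi> x * \<phi> y"
    and rep_one: "\<phi> 1 = 1\<^sub>m n"

text \<open>Multiplicativity of \<open>x \<mapsto> x \<otimes> 1\<close> comes from the multiplication of the monoid ring, while
  additivity is one of the relators of the tensor product.\<close>
lemma splitting_embedding_rep:
  fixes \<iota>D :: "'f::field \<Rightarrow> 'd::division_ring" and \<iota>K :: "'f \<Rightarrow> 'k::field"
  assumes "splitting_iso \<iota>D \<iota>K n \<Theta>"
  shows "division_algebra_rep (splitting_embedding \<iota>D \<iota>K \<Theta>) n"
proof -
  let ?I = "tensor_ideal \<iota>D \<iota>K" and ?\<phi> = "splitting_embedding \<iota>D \<iota>K \<Theta>"
  interpret P: ring "pair_ring :: ('d \<times> 'k \<Rightarrow>\<^sub>0 int) ring"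
    by (rule ring_pair_ring)
  have I: "ideal ?I pair_ring"
    unfolding tensor_ideal_def by (rule P.genideal_ideal) (simp add: pair_ring_simps)
  interpret I: ideal ?I pair_ring
    by (rule I)
  let ?q = "a_r_coset pair_ring ?I"
  have q: "?q \<in> Ring.ring_hom pair_ring (tensor_ring \<iota>D \<iota>K)"
    unfolding tensor_ring_def by (rule I.rcos_ring_hom)
  have \<Theta>: "\<Theta> \<in> Ring.ring_hom (tensor_ring \<iota>D \<iota>K) (ring_mat TYPE('k) n ())"
    using assms by (auto simp: splitting_iso_def ring_iso_def)
  have hom: "\<Theta> \<circ> ?q \<in> Ring.ring_hom pair_ring (ring_mat TYPE('k) n ())"
    using ring_hom_trans[OF q \<Theta>] .
  have \<phi>: "?\<phi> x = (\<Theta> \<circ> ?q) (frag_of (x, 1))" for x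
    by (simp add: splitting_embedding_def pure_tensor_def)
  have rel: "frag_of (x + y, 1) - (frag_of (x, 1) + frag_of (y, 1)) \<in> ?I" for x y
    using P.genideal_self[of "tensor_relators \<iota>D \<iota>K"]
    by (auto simp: tensor_ideal_def tensor_relators_def pair_ring_simps)
  have add: "?q (frag_of (x + y, 1)) = ?q (frag_of (x, 1) + frag_of (y, 1))" for x y
  proof -
    have "frag_of (x + y, 1) \<in> ?q (frag_of (x, 1) + frag_of (y, 1))"
      unfolding a_r_coset_def r_coset_def using rel[of x y]
      by (auto simp: pair_ring_simps intro!: bexI)
    thus ?thesis
      using P.a_repr_independence'[OF _ _ I.a_subgroup] by (simp add: a_r_coset_def pair_ring_simps)
  qed
  show ?thesis
  proof
    fix x y
    show "?\<phi> x \<in> carrier_mat n n"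
      using ring_hom_closed[OF hom] by (simp add: \<phi> pair_ring_simps ring_mat_simps)
    show "?\<phi> (x + y) = ?\<phi> x + ?\<phi> y"
      using ring_hom_add[OF hom, of "frag_of (x, 1)" "frag_of (y, 1)"] add[of x y]
      by (simp add: \<phi> pair_ring_simps ring_mat_simps)
    show "?\<phi> (x * y) = ?\<phi> x * ?\<phi> y"
      using ring_hom_mult[OF hom, of "frag_of (x, 1)" "frag_of (y, 1)"]
      by (simp add: \<phi> pair_ring_simps ring_mat_simps pair_mult_frag_of)
    show "?\<phi> 1 = 1\<^sub>m n"
      using ring_hom_one[OF hom] by (simp add: \<phi> pair_ring_simps ring_mat_simps)
  qed
qed

section \<open>Monomial matrices\<close>

text \<open>The \<open>j\<close>-th basis vector is sent to \<open>c j\<close> times the \<open>\<sigma> j\<close>-th one.\<close>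
definition monomial_mat :: "nat \<Rightarrow> (nat \<Rightarrow> nat) \<Rightarrow> (nat \<Rightarrow> 'k::field) \<Rightarrow> 'k mat" where
  "monomial_mat n \<sigma> c = mat n n (\<lambda>(i, j). if i = \<sigma> j then c j else 0)"

lemma monomial_mat_closed [simp]: "monomial_mat n \<sigma> c \<in> carrier_mat n n"
  by (simp add: monomial_mat_def)

text \<open>In the Leibniz formula, which lets a permutation choose a column for each row, only the
  inverse of \<open>\<sigma>\<close> avoids the zero entries.\<close>
lemma det_monomial_mat:
  assumes \<sigma>: "\<sigma> permutes {..<n}"
  shows "det (monomial_mat n \<sigma> c) = signof \<sigma> * (\<Prod>j<n. c j)"
proof -
  have inv: "inv_into UNIV \<sigma> permutes {..<n}"
    using \<sigma> by (rule permutes_inv)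
  have vanish: "(\<Prod>i<n. monomial_mat n \<sigma> c $$ (i, p i)) = 0"
    if p: "p permutes {..<n}" "p \<noteq> inv_into UNIV \<sigma>" for p
  proof -
    obtain i where "p i \<noteq> inv_into UNIV \<sigma> i"
      using p(2) by blast
    moreover from this have "i < n"
      using p(1) inv by (metis lessThan_iff permutes_not_in)
    moreover from p(1) this have "p i < n"
      by (metis lessThan_iff permutes_in_image)
    ultimately have "monomial_mat n \<sigma> c $$ (i, p i) = 0"
      using permutes_inverses(2)[OF \<sigma>, of "p i"] by (auto simp: monomial_mat_def)
    thus ?thesis
      using \<open>i < n\<close> by (auto intro!: prod_zero)
  qed
  have "det (monomial_mat n \<sigma> c)
    = (\<Sum>p\<in>{p. p permutes {..<n}}. signof p * (\<Prod>i<n. monomial_mat n \<sigma> c $$ (i, p i)))"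
    by (simp add: det_def'[OF monomial_mat_closed] atLeast0LessThan)
  also have "\<dots> = (\<Sum>p\<in>{inv_into UNIV \<sigma>}. signof p * (\<Prod>i<n. monomial_mat n \<sigma> c $$ (i, p i)))"
    using inv vanish by (intro sum.mono_neutral_right) (auto simp: finite_permutations)
  also have "\<dots> = signof \<sigma> * (\<Prod>i<n. monomial_mat n \<sigma> c $$ (i, inv_into UNIV \<sigma> i))"
    using \<sigma> by (simp add: signof_inv[of "{..<n}"])
  also have "(\<Prod>i<n. monomial_mat n \<sigma> c $$ (i, inv_into UNIV \<sigma> i)) = (\<Prod>j<n. monomial_mat n \<sigma> c $$ (\<sigma> j, j))"
    by (rule prod.reindex_bij_witness[of _ \<sigma> "inv_into UNIV \<sigma>"])
      (use \<sigma> inv in \<open>auto simp: permutes_inverses permutes_in_image[of _ "{..<n}", simplified lessThan_iff]\<close>)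
  also have "\<dots> = (\<Prod>j<n. c j)"
    using permutes_in_image[OF \<sigma>] by (intro prod.cong) (auto simp: monomial_mat_def)
  finally show ?thesis .
qed

lemma col_monomial_mat:
  assumes "j < n"
  shows "col (monomial_mat n \<sigma> c) j = c j \<cdot>\<^sub>v unit_vec n (\<sigma> j)"
  using assms by (auto simp: monomial_mat_def unit_vec_def)

lemma mat_mult_unit_vec:
  fixes P :: "'k::field mat"
  assumes "P \<in> carrier_mat m n" "j < n"
  shows "P *\<^sub>v unit_vec n j = col P j"
  using assms by (intro eq_vecI) auto

lemma nonsingular_col_nonzero:
  fixes P :: "'k::field mat"
  assumes P: "P \<in> carrier_mat n n" "det P \<noteq> 0" and j: "j < n"
  shows "col P j \<noteq> 0\<^sub>v n"
proof
  assume "col P j = 0\<^sub>v n"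
  moreover have "col P j = P *\<^sub>v unit_vec n j"
    using P j by (simp add: mat_mult_unit_vec)
  moreover have "unit_vec n j \<noteq> (0\<^sub>v n :: 'k vec)"
    using j by (metis index_unit_vec(2) index_zero_vec(1) zero_neq_one)
  ultimately show False
    using det_0_iff_vec_prod_zero_field[OF P(1)] P(2) by (metis unit_vec_carrier)
qed

lemma nonsingular_cols_not_proportional:
  fixes P :: "'k::field mat"
  assumes P: "P \<in> carrier_mat n n" "det P \<noteq> 0" and ij: "i < n" "j < n"
    and eq: "a \<cdot>\<^sub>v col P i = b \<cdot>\<^sub>v col P j" and "a \<noteq> 0"
  shows "i = j"
proof (rule ccontr)
  assume "i \<noteq> j"
  let ?w = "a \<cdot>\<^sub>v unit_vec n i - b \<cdot>\<^sub>v unit_vec n j"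
  have "P *\<^sub>v ?w = a \<cdot>\<^sub>v col P i - b \<cdot>\<^sub>v col P j"
    using P ij by (simp add: mult_minus_distrib_mat_vec mult_mat_vec mat_mult_unit_vec)
  also have "\<dots> = 0\<^sub>v n"
    using P ij eq by auto
  finally have "?w = 0\<^sub>v n"
    using det_0_iff_vec_prod_zero_field[OF P(1)] P(2)
    by (metis minus_carrier_vec smult_carrier_vec unit_vec_carrier)
  moreover have "?w $ i = a"
    using ij \<open>i \<noteq> j\<close> by simp
  ultimately show False
    using \<open>a \<noteq> 0\<close> ij by simp
qed

lemma monomial_mat_mult_vec:
  assumes "\<sigma> permutes {..<n}" "x \<in> carrier_vec n" "j < n"
  shows "(monomial_mat n \<sigma> c *\<^sub>v x) $ \<sigma> j = c j * x $ j"
proof -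
  have "\<sigma> j < n"
    using assms permutes_in_image[OF assms(1), of j] by simp
  hence "(monomial_mat n \<sigma> c *\<^sub>v x) $ \<sigma> j = (\<Sum>k<n. (if \<sigma> j = \<sigma> k then c k else 0) * x $ k)"
    using assms by (auto simp: monomial_mat_def scalar_prod_def atLeast0LessThan intro!: sum.cong)
  also have "\<dots> = (\<Sum>k<n. if k = j then c k * x $ k else 0)"
    using inj_eq[OF permutes_inj[OF assms(1)], of j] by (intro sum.cong) auto
  also have "\<dots> = c j * x $ j"
    using assms by simp
  finally show ?thesis .
qed

text \<open>Coordinate subspaces and coordinate lattices are both given by a condition on each
  coordinate separately; this is the common reason why monomial matrices permute them.\<close>
lemma monomial_mat_image_cartesian:
  fixes A B :: "nat \<Rightarrow> 'k::field set"
  assumes \<sigma>: "\<sigma> permutes {..<n}" and c: "\<And>j. j < n \<Longrightarrow> c j \<noteq> 0"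
    and AB: "\<And>j a. j < n \<Longrightarrow> c j * a \<in> B (\<sigma> j) \<longleftrightarrow> a \<in> A j"
  shows "mat_image (monomial_mat n \<sigma> c) {x \<in> carrier_vec n. \<forall>j<n. x $ j \<in> A j}
    = {x \<in> carrier_vec n. \<forall>j<n. x $ j \<in> B j}" (is "mat_image ?M ?X = ?Y")
proof (intro equalityI subsetI)
  fix y assume "y \<in> mat_image ?M ?X"
  then obtain x where x: "x \<in> carrier_vec n" "\<And>j. j < n \<Longrightarrow> x $ j \<in> A j" "y = ?M *\<^sub>v x"
    by (auto simp: mat_image_def)
  have "y $ i \<in> B i" if "i < n" for i
  proof -
    have "i \<in> \<sigma> ` {..<n}"
      using permutes_image[OF \<sigma>] that by simp
    then obtain j where "j < n" "i = \<sigma> j"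
      by blast
    thus ?thesis
      using x AB monomial_mat_mult_vec[OF \<sigma> x(1)] by simp
  qed
  moreover have "y \<in> carrier_vec n"
    using x(1,3) mult_mat_vec_carrier[OF monomial_mat_closed] by simp
  ultimately show "y \<in> ?Y"
    by simp
next
  fix y assume y: "y \<in> ?Y"
  define x where "x = vec n (\<lambda>j. y $ \<sigma> j / c j)"
  have x: "x \<in> carrier_vec n"
    by (simp add: x_def)
  have image: "c j * x $ j = y $ \<sigma> j" if "j < n" for j
    using c that by (simp add: x_def)
  have "?M *\<^sub>v x = y"
  proof (rule eq_vecI)
    fix i assume "i < dim_vec y"
    hence "i < n"
      using y by auto
    hence "i \<in> \<sigma> ` {..<n}"
      using permutes_image[OF \<sigma>] by simp
    then obtain j where "j < n" "i = \<sigma> j"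
      by blast
    thus "(?M *\<^sub>v x) $ i = y $ i"
      using monomial_mat_mult_vec[OF \<sigma> x] image by simp
  qed (use y in \<open>auto simp: monomial_mat_def\<close>)
  moreover have "x $ j \<in> A j" if "j < n" for j
  proof -
    have "\<sigma> j < n"
      using that permutes_in_image[OF \<sigma>, of j] by simp
    thus ?thesis
      using AB[OF that, of "x $ j"] image[OF that] y by simp
  qed
  ultimately show "y \<in> mat_image ?M ?X"
    using x unfolding mat_image_def by blast
qed

definition coord_proj :: "nat \<Rightarrow> nat \<Rightarrow> 'k::field vec \<Rightarrow> 'k vec" where
  "coord_proj n i x = vec n (\<lambda>k. if k = i then x $ i else 0)"

text \<open>A nonzero vector spans a coordinate line if and only if its line is stable under all coordinate
  projections. So the hypothesis says that \<open>g\<close> maps coordinate lines to coordinate lines. It is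
  stated with projections because the sets attached to an apartment, subspaces and lattices alike,
  are stable under them.\<close>
lemma monomial_if_projections_on_column_lines:
  fixes g :: "'k::field mat"
  assumes g: "g \<in> carrier_mat n n" "det g \<noteq> 0"
    and proj: "\<And>i j. i < n \<Longrightarrow> j < n \<Longrightarrow> \<exists>a. coord_proj n i (col g j) = a \<cdot>\<^sub>v col g j"
  obtains \<sigma> c where "\<sigma> permutes {..<n}" "\<And>j. j < n \<Longrightarrow> c j \<noteq> 0" "g = monomial_mat n \<sigma> c"
proof -
  have "\<exists>p. p permutes {..<n} \<and> (\<Prod>i<n. g $$ (i, p i)) \<noteq> 0"
  proof (rule ccontr)
    assume "\<not> ?thesis"
    hence "det g = 0"
      by (auto simp: det_def'[OF g(1)] atLeast0LessThan intro!: sum.neutral)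
    with g(2) show False
      by simp
  qed
  then obtain p where p: "p permutes {..<n}" and entries: "\<And>i. i < n \<Longrightarrow> g $$ (i, p i) \<noteq> 0"
    by auto
  \<comment> \<open>A nonzero term of the Leibniz formula provides a nonzero entry of each column, in pairwise
    different rows.\<close>
  define \<sigma> where "\<sigma> = inv_into UNIV p"
  have \<sigma>: "\<sigma> permutes {..<n}"
    using p by (simp add: \<sigma>_def permutes_inv)
  have entry: "g $$ (\<sigma> j, j) \<noteq> 0" if "j < n" for j
    using entries[of "\<sigma> j"] permutes_in_image[OF \<sigma>, of j] that p
    by (simp add: \<sigma>_def permutes_inverses)
  have other: "g $$ (i, j) = 0" if ij: "i < n" "j < n" "i \<noteq> \<sigma> j" for i j
  proof -
    have "\<sigma> j < n"
      using permutes_in_image[OF \<sigma>, of j] that by simp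
    obtain a where a: "coord_proj n (\<sigma> j) (col g j) = a \<cdot>\<^sub>v col g j"
      using proj[OF \<open>\<sigma> j < n\<close> ij(2)] by (rule exE)
    have "g $$ (\<sigma> j, j) = a * g $$ (\<sigma> j, j)"
      using arg_cong[OF a, of "\<lambda>w. w $ \<sigma> j"] \<open>\<sigma> j < n\<close> that g by (simp add: coord_proj_def)
    hence "a = 1"
      using entry that by simp
    moreover have "0 = a * g $$ (i, j)"
      using arg_cong[OF a, of "\<lambda>w. w $ i"] \<open>\<sigma> j < n\<close> that g by (simp add: coord_proj_def)
    ultimately show ?thesis
      by simp
  qed
  have eq: "g = monomial_mat n \<sigma> (\<lambda>j. g $$ (\<sigma> j, j))"
    using g other by (intro eq_matI) (auto simp: monomial_mat_def)
  show ?thesis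
    by (rule that[OF \<sigma> _ eq]) (rule entry)
qed

section \<open>Monomial elements of a division algebra\<close>

context division_algebra_rep
begin

lemma rep_diff: "\<phi> (x - y) = \<phi> x - \<phi> y"
proof -
  have "\<phi> (x - y) + \<phi> y = \<phi> x"
    using rep_add[of "x - y" y] by simp
  moreover have "\<phi> (x - y) + \<phi> y - \<phi> y = \<phi> (x - y)"
    by (rule eq_matI) (use rep_closed[of "x - y"] rep_closed[of y] in \<open>auto simp del: rep_closed\<close>)
  ultimately show ?thesis
    by simp
qed

lemma rep_minus_one: "\<phi> (- 1) = - 1\<^sub>m n"
proof -
  have "\<phi> (0 - 1) = \<phi> 1 - \<phi> 1 - \<phi> 1"
    by (simp add: rep_diff[symmetric])
  thus ?thesis
    by (auto simp: rep_one)
qed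

lemma rep_mult_vec: "w \<in> carrier_vec n \<Longrightarrow> \<phi> (x * y) *\<^sub>v w = \<phi> x *\<^sub>v (\<phi> y *\<^sub>v w)"
  by (simp add: rep_mult assoc_mult_mat_vec[OF rep_closed rep_closed])

text \<open>If \<open>x \<noteq> y\<close>, then \<open>x - y\<close> has an inverse in the division ring, and so its matrix has trivial
  kernel.\<close>
lemma eq_if_agree_on_vector:
  assumes w: "w \<in> carrier_vec n" "w \<noteq> 0\<^sub>v n" and eq: "\<phi> x *\<^sub>v w = \<phi> y *\<^sub>v w"
  shows "x = y"
proof (rule ccontr)
  assume "x \<noteq> y"
  hence "w = \<phi> (inverse (x - y) * (x - y)) *\<^sub>v w"
    using w by (simp add: rep_one)
  also have "\<dots> = \<phi> (inverse (x - y)) *\<^sub>v (\<phi> (x - y) *\<^sub>v w)"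
    using w by (simp add: rep_mult_vec)
  also have "\<phi> (x - y) *\<^sub>v w = 0\<^sub>v n"
    using w mult_mat_vec_carrier[OF rep_closed w(1), of y]
    by (simp add: rep_diff minus_mult_distrib_mat_vec[OF rep_closed rep_closed] eq del: mult_mat_vec_carrier)
  finally have "w = \<phi> (inverse (x - y)) *\<^sub>v 0\<^sub>v n" .
  also have "\<dots> = 0\<^sub>v n"
    using rep_closed[of "inverse (x - y)"] by (intro eq_vecI) (auto simp del: rep_closed)
  finally show False
    using w by simp
qed

text \<open>The columns of \<open>P\<close> are a basis; \<open>\<phi> x * P = P * M\<close> says that \<open>M\<close> is the matrix of \<open>\<phi> x\<close> in
  this basis. For \<open>n \<ge> 4\<close> the transpositions \<open>(0 1)\<close> and \<open>(1 2)\<close> have the common fixed index \<open>3\<close>;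
  for \<open>n = 3\<close> they have none, and the determinant is used instead.\<close>
lemma not_all_permutations_realised:
  assumes P: "P \<in> carrier_mat n n" "det P \<noteq> 0" and "n > 2"
    and realised: "\<And>\<sigma>. \<sigma> permutes {..<n} \<Longrightarrow>
      \<exists>x c. \<phi> x * P = P * monomial_mat n \<sigma> c \<and> det (\<phi> x) = 1"
  shows False
proof -
  define b where "b = col P"
  have b: "b j \<in> carrier_vec n" "b j \<noteq> 0\<^sub>v n" if "j < n" for j
    using P that nonsingular_col_nonzero[OF P that] by (auto simp: b_def)
  have act: "\<phi> x *\<^sub>v b j = c j \<cdot>\<^sub>v b (\<sigma> j)"
    if "\<phi> x * P = P * monomial_mat n \<sigma> c" "j < n" "\<sigma> permutes {..<n}" for x c \<sigma> j
  proof -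
    have "\<sigma> j < n"
      using that permutes_in_image[OF that(3), of j] by simp
    have "\<phi> x *\<^sub>v b j = col (\<phi> x * P) j"
      using col_mult2[OF rep_closed P(1) \<open>j < n\<close>] by (simp add: b_def)
    also have "\<dots> = P *\<^sub>v (c j \<cdot>\<^sub>v unit_vec n (\<sigma> j))"
      using col_mult2[OF P(1) monomial_mat_closed \<open>j < n\<close>] that by (simp add: col_monomial_mat)
    also have "\<dots> = c j \<cdot>\<^sub>v b (\<sigma> j)"
      using P \<open>\<sigma> j < n\<close> by (simp add: b_def mult_mat_vec mat_mult_unit_vec)
    finally show ?thesis .
  qed
  have perm: "Transposition.transpose 0 1 permutes {..<n}" "Transposition.transpose 1 2 permutes {..<n}"
    using \<open>n > 2\<close> by (auto intro!: permutes_swap_id)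
  obtain x c where x: "\<phi> x * P = P * monomial_mat n (Transposition.transpose 0 1) c" "det (\<phi> x) = 1"
    using realised[OF perm(1)] by blast
  obtain y e where y: "\<phi> y * P = P * monomial_mat n (Transposition.transpose 1 2) e" "det (\<phi> y) = 1"
    using realised[OF perm(2)] by blast
  have nonzero: "c j \<noteq> 0" "e j \<noteq> 0" if "j < n" for j
  proof -
    have "det (\<phi> x) * det P = det P * det (monomial_mat n (Transposition.transpose 0 1) c)"
      "det (\<phi> y) * det P = det P * det (monomial_mat n (Transposition.transpose 1 2) e)"
      using x(1) y(1) P by (metis det_mult monomial_mat_closed rep_closed)+
    hence "signof (Transposition.transpose 0 1 :: nat \<Rightarrow> nat) * (\<Prod>j<n. c j) = 1"
      "signof (Transposition.transpose 1 2 :: nat \<Rightarrow> nat) * (\<Prod>j<n. e j) = 1"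
      using x(2) y(2) P(2) unfolding det_monomial_mat[OF perm(1)] det_monomial_mat[OF perm(2)]
      by simp_all
    hence "(\<Prod>j<n. c j) \<noteq> 0" "(\<Prod>j<n. e j) \<noteq> 0"
      by (metis mult_zero_right zero_neq_one)+
    thus "c j \<noteq> 0" "e j \<noteq> 0"
      using that by auto
  qed
  note xb = act[OF x(1) _ perm(1)] and yb = act[OF y(1) _ perm(2)]
  have smult: "\<phi> z *\<^sub>v (a \<cdot>\<^sub>v b j) = a \<cdot>\<^sub>v (\<phi> z *\<^sub>v b j)" if "j < n" for z a j
    using b[OF that] by (simp add: mult_mat_vec[OF rep_closed])
  have lt: "0 < n" "1 < n" "2 < n"
    using \<open>n > 2\<close> by auto
  have tr: "Transposition.transpose 0 1 (0::nat) = 1" "Transposition.transpose 0 1 (1::nat) = 0"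
    "Transposition.transpose 0 1 (2::nat) = 2" "Transposition.transpose 0 1 (3::nat) = 3"
    "Transposition.transpose 1 2 (0::nat) = 0" "Transposition.transpose 1 2 (1::nat) = 2"
    "Transposition.transpose 1 2 (2::nat) = 1" "Transposition.transpose 1 2 (3::nat) = 3"
    by (simp_all add: Transposition.transpose_def)
  have word: "\<phi> (z * z') *\<^sub>v b j = a \<cdot>\<^sub>v (\<phi> z *\<^sub>v b k)"
    if "\<phi> z' *\<^sub>v b j = a \<cdot>\<^sub>v b k" "j < n" "k < n" for z z' a j k
    using that b[of j] smult by (simp add: rep_mult_vec)
  note x0 = xb[OF lt(1), unfolded tr] and x1 = xb[OF lt(2), unfolded tr]
    and x2 = xb[OF lt(3), unfolded tr] and y0 = yb[OF lt(1), unfolded tr]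
    and y1 = yb[OF lt(2), unfolded tr] and y2 = yb[OF lt(3), unfolded tr]
  show False
  proof (cases "n = 3")
    case False
    hence "3 < n"
      using \<open>n > 2\<close> by simp
    note x3 = xb[OF \<open>3 < n\<close>, unfolded tr] and y3 = yb[OF \<open>3 < n\<close>, unfolded tr]
    \<comment> \<open>Both elements fix the line of \<open>b 3\<close>, so they commute there and hence everywhere.\<close>
    have "\<phi> (x * y) *\<^sub>v b 3 = \<phi> (y * x) *\<^sub>v b 3"
      unfolding word[OF y3 \<open>3 < n\<close> \<open>3 < n\<close>] word[OF x3 \<open>3 < n\<close> \<open>3 < n\<close>] x3 y3
      by (simp add: smult_smult_assoc mult.commute)
    hence "x * y = y * x"
      using eq_if_agree_on_vector b[OF \<open>3 < n\<close>] by blast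
    \<comment> \<open>But \<open>x * y\<close> sends the line of \<open>b 0\<close> to that of \<open>b 1\<close>, and \<open>y * x\<close> sends it to that of \<open>b 2\<close>.\<close>
    hence "\<phi> (x * y) *\<^sub>v b 0 = \<phi> (y * x) *\<^sub>v b 0"
      by simp
    hence "(e 0 * c 0) \<cdot>\<^sub>v b 1 = (c 0 * e 1) \<cdot>\<^sub>v b 2"
      unfolding word[OF y0 lt(1) lt(1)] word[OF x0 lt(1) lt(2)] x0 y1
      by (simp add: smult_smult_assoc)
    hence "(1::nat) = 2"
      using nonsingular_cols_not_proportional[OF P lt(2,3), of "e 0 * c 0"] nonzero[OF lt(1)]
      unfolding b_def by (metis mult_eq_0_iff)
    thus False
      by simp
  next
    case n: True
    have xx0: "\<phi> (x * x) *\<^sub>v b 0 = (c 0 * c 1) \<cdot>\<^sub>v b 0"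
      unfolding word[OF x0 lt(1) lt(2)] x1 by (simp add: smult_smult_assoc)
    have xx1: "\<phi> (x * x) *\<^sub>v b 1 = (c 1 * c 0) \<cdot>\<^sub>v b 1"
      unfolding word[OF x1 lt(2) lt(1)] x0 by (simp add: smult_smult_assoc)
    have xx2: "\<phi> (x * x) *\<^sub>v b 2 = (c 2 * c 2) \<cdot>\<^sub>v b 2"
      unfolding word[OF x2 lt(3) lt(3)] x2 by (simp add: smult_smult_assoc)
    \<comment> \<open>The diagonal element \<open>x * x\<close> and \<open>y\<close> share the eigenvector \<open>b 0\<close>, so they commute. Since \<open>y\<close>
      exchanges the lines of \<open>b 1\<close> and \<open>b 2\<close>, the eigenvalues of \<open>x * x\<close> on these agree.\<close>
    have "\<phi> (x * x * y) *\<^sub>v b 0 = \<phi> (y * (x * x)) *\<^sub>v b 0"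
      unfolding word[OF y0 lt(1) lt(1)] word[OF xx0 lt(1) lt(1)] xx0 y0
      by (simp add: smult_smult_assoc mult_ac)
    hence "x * x * y = y * (x * x)"
      using eq_if_agree_on_vector b[OF lt(1)] by blast
    hence "\<phi> (x * x * y) *\<^sub>v b 1 = \<phi> (y * (x * x)) *\<^sub>v b 1"
      by simp
    hence *: "(e 1 * (c 2 * c 2)) \<cdot>\<^sub>v b 2 = (c 1 * c 0 * e 1) \<cdot>\<^sub>v b 2"
      unfolding word[OF y1 lt(2) lt(3)] word[OF xx1 lt(2) lt(2)] xx2 y1
      by (simp add: smult_smult_assoc)
    obtain i where i: "i < n" "b 2 $ i \<noteq> 0"
      using b[OF lt(3)] by (metis carrier_vecD eq_vecI index_zero_vec)
    have "(e 1 * (c 2 * c 2)) * b 2 $ i = (c 1 * c 0 * e 1) * b 2 $ i"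
      using arg_cong[OF *, of "\<lambda>w. w $ i"] i b[OF lt(3)] by simp
    hence square: "c 2 * c 2 = c 0 * c 1"
      using nonzero(2)[OF lt(2)] i(2) by simp
    have "det (\<phi> x) * det P = det P * det (monomial_mat n (Transposition.transpose 0 1) c)"
      using x(1) P by (metis det_mult monomial_mat_closed rep_closed)
    hence "signof (Transposition.transpose 0 1 :: nat \<Rightarrow> nat) * (\<Prod>j<n. c j) = 1"
      using x(2) P(2) unfolding det_monomial_mat[OF perm(1)] by simp
    moreover have "(\<Prod>j<n. c j) = c 0 * c 1 * c 2"
      by (simp add: n numeral_3_eq_3 numeral_2_eq_2)
    \<comment> \<open>The minus sign is the sign of the transposition.\<close>
    ultimately have "- (c 0 * c 1 * c 2) = 1"
      by (simp add: sign_swap_id)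
    hence cube: "c 2 * c 2 * c 2 = - 1"
      unfolding square by (simp add: minus_equation_iff)
    \<comment> \<open>So \<open>x\<^sup>3\<close> agrees with \<open>- 1\<close> at \<open>b 2\<close>, hence everywhere; but it moves the line of \<open>b 0\<close>.\<close>
    have "\<phi> (x * (x * x)) *\<^sub>v b 2 = \<phi> (- 1) *\<^sub>v b 2"
      unfolding word[OF xx2 lt(3) lt(3)] x2 smult_smult_assoc cube
      using b[OF lt(3)] by (auto simp: rep_minus_one)
    hence "x * (x * x) = - 1"
      using eq_if_agree_on_vector b[OF lt(3)] by blast
    hence "\<phi> (x * (x * x)) *\<^sub>v b 0 = \<phi> (- 1) *\<^sub>v b 0"
      by simp
    hence "(c 0 * c 1 * c 0) \<cdot>\<^sub>v b 1 = (- 1) \<cdot>\<^sub>v b 0"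
      unfolding word[OF xx0 lt(1) lt(1)] x0 smult_smult_assoc
      using b[OF lt(1)] by (auto simp: rep_minus_one)
    hence "(1::nat) = 0"
      using nonsingular_cols_not_proportional[OF P lt(2,1), of "c 0 * c 1 * c 0"]
        nonzero(1)[OF lt(1)] nonzero(1)[OF lt(2)]
      unfolding b_def by (metis mult_eq_0_iff)
    thus False
      by simp
  qed
qed

end

text \<open>The matrices in \<open>H\<close> that are monomial with respect to a suitable basis, the columns of \<open>P\<close>,
  induce all permutations of this basis.\<close>
definition realises_all_permutations :: "nat \<Rightarrow> 'k::field mat set \<Rightarrow> bool" where
  "realises_all_permutations n H \<longleftrightarrow>
    (\<exists>P\<in>carrier_mat n n. det P \<noteq> 0 \<and>
      (\<forall>\<sigma>. \<sigma> permutes {..<n} \<longrightarrow> (\<exists>h\<in>H. \<exists>c. h * P = P * monomial_mat n \<sigma> c)))"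

lemma (in division_algebra_rep) SL1_not_realises_all_permutations:
  assumes "n > 2"
  shows "\<not> realises_all_permutations n (SL1 \<phi>)"
  using not_all_permutations_realised[OF _ _ assms]
  unfolding realises_all_permutations_def SL1_def by blast

section \<open>Bases as nonsingular matrices\<close>

text \<open>A basis is handled through a matrix having it as set of columns. This amounts to a numbering
  of the basis, and turns coordinates with respect to it into ordinary coordinates.\<close>
lemma basis_iff_cols_nonsingular:
  fixes B :: "'k::field vec set"
  shows "vectorspace.basis class_ring (vec_sp n) B \<longleftrightarrow>
    (\<exists>P\<in>carrier_mat n n. det P \<noteq> 0 \<and> set (cols P) = B)"
proof -
  interpret V: vec_space "TYPE('k)" n .
  show ?thesis
  proof
    assume B: "V.basis B"
    hence li: "V.lin_indpt B" "B \<subseteq> carrier_vec n"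
      by (auto simp: V.basis_def)
    have fin: "finite B"
      using V.fin_dim_li_fin[OF V.fin_dim] li by auto
    hence card: "card B = n"
      using V.dim_basis[OF fin B] V.dim_is_n by simp
    obtain bs where bs: "set bs = B" "distinct bs"
      using finite_distinct_list[OF fin] by blast
    define P where "P = mat_of_cols n bs"
    have "length bs = n"
      using bs card distinct_card by fastforce
    hence P: "P \<in> carrier_mat n n"
      using mat_of_cols_carrier(1)[of n bs] by (simp add: P_def)
    moreover have cols: "cols P = bs"
      unfolding P_def using bs li by (intro cols_mat_of_cols) auto
    moreover have "det P \<noteq> 0"
      using V.lin_indpt_full_rank[OF P] V.det_rank_iff[OF P] li bs cols by simp
    ultimately show "\<exists>P\<in>carrier_mat n n. det P \<noteq> 0 \<and> set (cols P) = B"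
      using bs by blast
  next
    assume "\<exists>P\<in>carrier_mat n n. det P \<noteq> 0 \<and> set (cols P) = B"
    then obtain P where P: "P \<in> carrier_mat n n" "det P \<noteq> 0" "set (cols P) = B"
      by blast
    have dist: "distinct (cols P)"
      using V.non_distinct_low_rank[OF P(1)] V.det_rank_iff[OF P(1)] P(2) by auto
    have "V.lin_indpt B"
      using V.lin_dep_cols_imp_det_0[OF P(1)] P by blast
    moreover have "B \<subseteq> carrier_vec n"
      using P cols_dim by blast
    moreover have "card B = n"
      using dist P distinct_card[OF dist] by simp
    ultimately show "V.basis B"
      using V.dim_li_is_basis[OF V.fin_dim, of B] P V.dim_is_n by auto
  qed
qed

lemma mat_image_mult:
  assumes "A \<in> carrier_mat n n" "B \<in> carrier_mat n n" "W \<subseteq> carrier_vec n"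
  shows "mat_image (A * B) W = mat_image A (mat_image B W)"
  using assms unfolding mat_image_def image_image
  by (intro image_cong) (auto simp: subset_iff)

lemma mat_image_carrier:
  assumes "A \<in> carrier_mat n n" "W \<subseteq> carrier_vec n"
  shows "mat_image A W \<subseteq> carrier_vec n"
  using assms by (auto simp: mat_image_def subset_iff)

lemma nonsingular_inverse:
  fixes P :: "'k::field mat"
  assumes "P \<in> carrier_mat n n" "det P \<noteq> 0"
  obtains Q where "Q \<in> carrier_mat n n" "Q * P = 1\<^sub>m n" "P * Q = 1\<^sub>m n"
  using det_non_zero_imp_unit[OF assms, of "()"]
  by (auto simp: Units_def ring_mat_simps)

lemma inj_on_nonsingular:
  fixes P :: "'k::field mat"
  assumes P: "P \<in> carrier_mat n n" "det P \<noteq> 0"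
  shows "inj_on (\<lambda>x. P *\<^sub>v x) (carrier_vec n)"
proof -
  obtain Q where Q: "Q \<in> carrier_mat n n" "Q * P = 1\<^sub>m n"
    using nonsingular_inverse[OF P] by blast
  show ?thesis
  proof (rule inj_on_inverseI)
    fix x :: "'k vec"
    assume "x \<in> carrier_vec n"
    thus "Q *\<^sub>v (P *\<^sub>v x) = x"
      using assoc_mult_mat_vec[OF Q(1) P(1)] Q(2) by (metis one_mult_mat_vec)
  qed
qed

lemma mat_image_subset_iff:
  fixes P :: "'k::field mat"
  assumes "P \<in> carrier_mat n n" "det P \<noteq> 0" "X \<subseteq> carrier_vec n" "Y \<subseteq> carrier_vec n"
  shows "mat_image P X \<subseteq> mat_image P Y \<longleftrightarrow> X \<subseteq> Y"
  using inj_on_image_mem_iff[OF inj_on_nonsingular[OF assms(1,2)]] assms(3,4)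
  unfolding mat_image_def by blast

lemma mat_image_eq_iff:
  fixes P :: "'k::field mat"
  assumes "P \<in> carrier_mat n n" "det P \<noteq> 0" "X \<subseteq> carrier_vec n" "Y \<subseteq> carrier_vec n"
  shows "mat_image P X = mat_image P Y \<longleftrightarrow> X = Y"
  using mat_image_subset_iff[OF assms(1,2)] assms(3,4) by (metis subset_antisym subset_refl)

text \<open>Passing to the matrix \<open>g\<close> of \<open>h\<close> with respect to the basis of columns of \<open>P\<close>.\<close>
lemma conjugate_matrix:
  fixes P :: "'k::field mat"
  assumes P: "P \<in> carrier_mat n n" "det P \<noteq> 0" and h: "h \<in> carrier_mat n n"
  obtains g where "g \<in> carrier_mat n n" "h * P = P * g" "det g = det h"
proof -
  obtain Q where Q: "Q \<in> carrier_mat n n" "P * Q = 1\<^sub>m n"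
    using nonsingular_inverse[OF P] by blast
  let ?g = "Q * (h * P)"
  have 1: "h * P = P * ?g"
    using assoc_mult_mat[OF P(1) Q(1), of "h * P" n] Q(2) P(1) h
    by (metis left_mult_one_mat mult_carrier_mat)
  hence "det h * det P = det P * det ?g"
    using P(1) h Q by (metis det_mult mult_carrier_mat)
  with 1 show ?thesis
    using that[of ?g] P h Q by simp
qed

section \<open>Initial segments of a permutation\<close>

lemma permutes_segment:
  assumes "\<pi> permutes {..<n}" "i \<le> n"
  shows "\<pi> ` {..<i} \<subseteq> {..<n}" "card (\<pi> ` {..<i}) = i"
proof -
  show "\<pi> ` {..<i} \<subseteq> {..<n}"
    using image_mono[of "{..<i}" "{..<n}" \<pi>] permutes_image[OF assms(1)] assms(2) by simp
  show "card (\<pi> ` {..<i}) = i"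
    using permutes_inj_on[OF assms(1)] by (simp add: card_image)
qed

text \<open>The images of the initial segments give back the numbering: \<open>\<sigma> i\<close> is the element by which
  the image of \<open>{..<Suc i}\<close> exceeds that of \<open>{..<i}\<close>.\<close>
lemma permutation_determined_by_initial_segments:
  assumes \<sigma>: "\<sigma> permutes {..<n}" and \<pi>: "\<pi> permutes {..<n}"
    and eq: "\<And>i. i < n \<Longrightarrow> \<sigma> ` {..<i} = \<pi> ` {..<i::nat}"
  shows "\<sigma> = \<pi>"
proof
  fix i
  have eq': "\<sigma> ` {..<i} = \<pi> ` {..<i}" if "i \<le> n" for i
    using eq[of i] that permutes_image[OF \<sigma>] permutes_image[OF \<pi>] by (cases "i = n") auto
  show "\<sigma> i = \<pi> i"
  proof (cases "i < n")
    case True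
    have "\<sigma> ` {..<Suc i} - \<sigma> ` {..<i} = \<pi> ` {..<Suc i} - \<pi> ` {..<i}"
      using eq'[of i] eq'[of "Suc i"] True by simp
    moreover have "f ` {..<Suc i} - f ` {..<i} = {f i}" if "f permutes {..<n}" for f
      using permutes_inj[OF that] by (auto simp: lessThan_Suc inj_eq)
    ultimately show ?thesis
      using \<sigma> \<pi> by simp
  qed (use \<sigma> \<pi> in \<open>auto simp: permutes_def\<close>)
qed

text \<open>This makes the flags of initial segments maximal: a set of indices that is comparable with the
  segment of its own size is equal to it.\<close>
lemma comparable_with_initial_segments:
  assumes \<pi>: "\<pi> permutes {..<n}" and J: "J \<subseteq> {..<n::nat}"
    and comparable: "J \<subseteq> \<pi> ` {..<card J} \<or> \<pi> ` {..<card J} \<subseteq> J"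
  shows "J = \<pi> ` {..<card J}"
proof -
  have "card (\<pi> ` {..<card J}) = card J"
    using permutes_inj_on[OF \<pi>] by (simp add: card_image)
  thus ?thesis
    using comparable J finite_subset[OF J] by (metis card_subset_eq finite_imageI finite_lessThan)
qed

section \<open>Apartments of the spherical building\<close>

definition coord_space :: "nat \<Rightarrow> nat set \<Rightarrow> 'k::field vec set" where
  "coord_space n J = {x \<in> carrier_vec n. \<forall>i<n. i \<notin> J \<longrightarrow> x $ i = 0}"

abbreviation frame_subspace :: "nat \<Rightarrow> 'k::field mat \<Rightarrow> nat set \<Rightarrow> 'k vec set" where
  "frame_subspace n P J \<equiv> mat_image P (coord_space n J)"

lemma coord_space_carrier: "coord_space n J \<subseteq> carrier_vec n"
  by (auto simp: coord_space_def)

lemma unit_vec_in_coord_space: "i < n \<Longrightarrow> unit_vec n i \<in> coord_space n J \<longleftrightarrow> i \<in> J"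
  by (auto simp: coord_space_def unit_vec_def)

lemma coord_space_subset_iff:
  assumes "J \<subseteq> {..<n}"
  shows "(coord_space n J :: 'k::field vec set) \<subseteq> coord_space n J' \<longleftrightarrow> J \<subseteq> J'"
proof
  assume *: "(coord_space n J :: 'k vec set) \<subseteq> coord_space n J'"
  show "J \<subseteq> J'"
  proof
    fix j assume "j \<in> J"
    moreover from this have "j < n"
      using assms by auto
    ultimately show "j \<in> J'"
      using * unit_vec_in_coord_space[of j n] by blast
  qed
qed (auto simp: coord_space_def)

lemma frame_subspace_subset_iff:
  fixes P :: "'k::field mat"
  assumes "P \<in> carrier_mat n n" "det P \<noteq> 0" "J \<subseteq> {..<n}"
  shows "frame_subspace n P J \<subseteq> frame_subspace n P J' \<longleftrightarrow> J \<subseteq> J'"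
  using mat_image_subset_iff[OF assms(1,2) coord_space_carrier coord_space_carrier]
    coord_space_subset_iff[OF assms(3)] by blast

lemma frame_subspace_eq_iff:
  fixes P :: "'k::field mat"
  assumes "P \<in> carrier_mat n n" "det P \<noteq> 0" "J \<subseteq> {..<n}" "J' \<subseteq> {..<n}"
  shows "frame_subspace n P J = frame_subspace n P J' \<longleftrightarrow> J = J'"
  using frame_subspace_subset_iff[OF assms(1,2)] assms(3,4) by (metis subset_antisym subset_refl)

lemma lincomb_cols_eq_mult_mat_vec:
  fixes P :: "'k::field mat"
  assumes P: "P \<in> carrier_mat n n" "det P \<noteq> 0" and J: "J \<subseteq> {..<n}"
  shows "LinearCombinations.module.lincomb (vec_sp n) a (col P ` J)
    = P *\<^sub>v vec n (\<lambda>j. if j \<in> J then a (col P j) else 0)" (is "?l = ?r")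
proof -
  interpret V: vec_space "TYPE('k)" n .
  have cols: "col P ` J \<subseteq> carrier_vec n" "finite (col P ` J)"
    using P J finite_subset[OF J] by auto
  have inj: "inj_on (col P) J"
    using nonsingular_cols_not_proportional[OF P, of _ _ 1 1] J by (intro inj_onI) auto
  show ?thesis
  proof (rule eq_vecI)
    show "dim_vec ?l = dim_vec ?r"
      using V.lincomb_dim[OF cols(2,1)] P by simp
    fix i assume "i < dim_vec ?r"
    hence i: "i < n"
      using P by simp
    have "?l $ i = (\<Sum>j\<in>J. a (col P j) * col P j $ i)"
      using V.lincomb_index[OF i cols(1)] sum.reindex[OF inj] by simp
    also have "\<dots> = (\<Sum>j\<in>{..<n}. if j \<in> J then a (col P j) * col P j $ i else 0)"
      using J by (simp add: sum.inter_restrict[symmetric] Int_absorb1)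
    also have "\<dots> = ?r $ i"
      using P i by (auto simp: scalar_prod_def atLeast0LessThan intro!: sum.cong)
    finally show "?l $ i = ?r $ i" .
  qed
qed

lemma span_cols_eq_frame_subspace:
  fixes P :: "'k::field mat"
  assumes P: "P \<in> carrier_mat n n" "det P \<noteq> 0" and J: "J \<subseteq> {..<n}"
  shows "LinearCombinations.module.span class_ring (vec_sp n) (col P ` J) = frame_subspace n P J"
proof -
  interpret V: vec_space "TYPE('k)" n .
  have cols: "col P ` J \<subseteq> carrier_vec n" "finite (col P ` J)"
    using P J finite_subset[OF J] by auto
  have inj: "inj_on (col P) J"
    using nonsingular_cols_not_proportional[OF P, of _ _ 1 1] J by (intro inj_onI) auto
  have "LinearCombinations.module.span class_ring (vec_sp n) (col P ` J)
    = {P *\<^sub>v vec n (\<lambda>j. if j \<in> J then a (col P j) else 0) | a. True}"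
    using V.finite_span[OF cols(2)] cols(1)
    by (simp add: lincomb_cols_eq_mult_mat_vec[OF P J])
  also have "\<dots> = frame_subspace n P J"
  proof (intro equalityI subsetI)
    fix w assume "w \<in> frame_subspace n P J"
    then obtain x where x: "x \<in> coord_space n J" "w = P *\<^sub>v x"
      by (auto simp: mat_image_def)
    define a where "a = (\<lambda>b. x $ the_inv_into J (col P) b)"
    have "vec n (\<lambda>j. if j \<in> J then a (col P j) else 0) = x"
      using x(1) by (intro eq_vecI) (auto simp: a_def coord_space_def the_inv_into_f_f[OF inj])
    thus "w \<in> {P *\<^sub>v vec n (\<lambda>j. if j \<in> J then a (col P j) else 0) | a. True}"
      using x(2) by blast
  qed (auto simp: mat_image_def coord_space_def)
  finally show ?thesis .
qed

lemma cols_as_image: "P \<in> carrier_mat n n \<Longrightarrow> set (cols P) = col P ` {..<n}"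
  by (auto simp: cols_def)

lemma basis_lines_cols:
  fixes P :: "'k::field mat"
  assumes P: "P \<in> carrier_mat n n" "det P \<noteq> 0"
  shows "basis_lines n (set (cols P)) = (\<lambda>j. frame_subspace n P {j}) ` {..<n}"
  using span_cols_eq_frame_subspace[OF P, of "{_}"]
  by (simp add: basis_lines_def cols_as_image[OF P(1)] image_image)

text \<open>The spans of sets of frame lines, of which the apartment is made, are therefore the images of
  the coordinate subspaces.\<close>
lemma span_frame_lines:
  fixes P :: "'k::field mat"
  assumes P: "P \<in> carrier_mat n n" "det P \<noteq> 0" and J: "J \<subseteq> {..<n}"
  shows "LinearCombinations.module.span class_ring (vec_sp n) (\<Union>j\<in>J. frame_subspace n P {j}) = frame_subspace n P J"
proof -
  interpret V: vec_space "TYPE('k)" n .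
  have cols: "col P ` J \<subseteq> carrier_vec n"
    using P J by auto
  have "(\<Union>j\<in>J. frame_subspace n P {j}) \<subseteq> frame_subspace n P J"
    by (auto simp: mat_image_def coord_space_def)
  moreover have "col P ` J \<subseteq> (\<Union>j\<in>J. frame_subspace n P {j})"
  proof
    fix b assume "b \<in> col P ` J"
    then obtain j where j: "j \<in> J" "b = col P j"
      by blast
    hence "j < n"
      using J by auto
    thus "b \<in> (\<Union>j\<in>J. frame_subspace n P {j})"
      using j unfolding mat_image_def
      by (intro UN_I[of j] image_eqI[of _ _ "unit_vec n j"])
        (simp_all add: mat_mult_unit_vec[OF P(1)] unit_vec_in_coord_space)
  qed
  moreover have "submodule class_ring (frame_subspace n P J) (vec_sp n)"
    using V.span_is_submodule[of "col P ` J"] cols span_cols_eq_frame_subspace[OF P J] by simp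
  ultimately show ?thesis
    using V.span_is_subset V.span_is_monotone span_cols_eq_frame_subspace[OF P J]
    by (metis subset_antisym)
qed

lemma frame_subspace_proper_iff:
  fixes P :: "'k::field mat"
  assumes P: "P \<in> carrier_mat n n" "det P \<noteq> 0" and J: "J \<subseteq> {..<n}"
  shows "frame_subspace n P J \<in> proper_subspaces n \<longleftrightarrow> J \<noteq> {} \<and> J \<noteq> {..<n}"
proof -
  interpret V: vec_space "TYPE('k)" n .
  have "col P ` J \<subseteq> carrier_vec n"
    using P J by auto
  hence "subspace class_ring (frame_subspace n P J) (vec_sp n)"
    using V.span_is_subspace[of "col P ` J"] span_cols_eq_frame_subspace[OF P J] by simp
  moreover have "frame_subspace n P J = {0\<^sub>v n} \<longleftrightarrow> J = {}"
  proof -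
    have "coord_space n {} = {0\<^sub>v n :: 'k vec}"
      by (auto simp: coord_space_def)
    moreover have "P *\<^sub>v 0\<^sub>v n = 0\<^sub>v n"
      using P(1) by (intro eq_vecI) auto
    ultimately have "frame_subspace n P {} = {0\<^sub>v n}"
      by (simp add: mat_image_def)
    thus ?thesis
      using frame_subspace_eq_iff[OF P J, of "{}"] by auto
  qed
  moreover have "frame_subspace n P J = carrier_vec n \<longleftrightarrow> J = {..<n}"
  proof -
    have "coord_space n {..<n} = (carrier_vec n :: 'k vec set)"
      by (auto simp: coord_space_def)
    moreover have "mat_image P (carrier_vec n) = carrier_vec n"
    proof -
      obtain Q where Q: "Q \<in> carrier_mat n n" "P * Q = 1\<^sub>m n"
        using nonsingular_inverse[OF P] by blast
      have "w = P *\<^sub>v (Q *\<^sub>v w)" if "w \<in> carrier_vec n" for w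
        using assoc_mult_mat_vec[OF P(1) Q(1) that] Q(2) that by simp
      moreover have "P *\<^sub>v w \<in> carrier_vec n" "Q *\<^sub>v w \<in> carrier_vec n" if "w \<in> carrier_vec n" for w
        using that P(1) Q(1) by auto
      ultimately show ?thesis
        unfolding mat_image_def by (metis (no_types, lifting) image_eqI image_subsetI subsetI subset_antisym)
    qed
    ultimately have "frame_subspace n P {..<n} = carrier_vec n"
      by simp
    thus ?thesis
      using frame_subspace_eq_iff[OF P J, of "{..<n}"] by auto
  qed
  ultimately show ?thesis
    by (auto simp: proper_subspaces_def)
qed

lemma mem_spherical_apartment_iff:
  fixes P :: "'k::field mat"
  assumes P: "P \<in> carrier_mat n n" "det P \<noteq> 0"
  shows "\<sigma> \<in> spherical_apartment n (basis_lines n (set (cols P))) \<longleftrightarrow>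
    \<sigma> \<in> spherical_building n \<and> (\<forall>W\<in>\<sigma>. \<exists>J\<subseteq>{..<n}. W = frame_subspace n P J)"
proof -
  have "(\<exists>M\<subseteq>basis_lines n (set (cols P)). W = LinearCombinations.module.span class_ring (vec_sp n) (\<Union>M))
    \<longleftrightarrow> (\<exists>J\<subseteq>{..<n}. W = frame_subspace n P J)" for W
  proof
    assume "\<exists>M\<subseteq>basis_lines n (set (cols P)). W = LinearCombinations.module.span class_ring (vec_sp n) (\<Union>M)"
    then obtain J where "J \<subseteq> {..<n}"
        "W = LinearCombinations.module.span class_ring (vec_sp n) (\<Union>j\<in>J. frame_subspace n P {j})"
      unfolding basis_lines_cols[OF P] subset_image_iff by blast
    thus "\<exists>J\<subseteq>{..<n}. W = frame_subspace n P J"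
      using span_frame_lines[OF P] by blast
  next
    assume "\<exists>J\<subseteq>{..<n}. W = frame_subspace n P J"
    then obtain J where "J \<subseteq> {..<n}" "W = frame_subspace n P J"
      by blast
    thus "\<exists>M\<subseteq>basis_lines n (set (cols P)). W = LinearCombinations.module.span class_ring (vec_sp n) (\<Union>M)"
      unfolding basis_lines_cols[OF P] using span_frame_lines[OF P, of J]
      by (intro exI[of _ "(\<lambda>j. frame_subspace n P {j}) ` J"]) auto
  qed
  thus ?thesis
    by (simp add: spherical_apartment_def)
qed

text \<open>The chamber of the ordering \<open>\<pi> 0, \<pi> 1, \<dots>\<close> of the columns of \<open>P\<close>. The indices \<open>0\<close> and \<open>n\<close> are left
  out because they give the improper subspaces.\<close>
definition segment_flag :: "nat \<Rightarrow> 'k::field mat \<Rightarrow> (nat \<Rightarrow> nat) \<Rightarrow> 'k vec set set" where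
  "segment_flag n P \<pi> = (\<lambda>i. frame_subspace n P (\<pi> ` {..<i})) ` {0<..<n}"

text \<open>A subspace of the frame is given by a set of indices, and compatibility with the flag means
  comparability with each initial segment.\<close>
lemma segment_flag_chamber:
  fixes P :: "'k::field mat"
  assumes P: "P \<in> carrier_mat n n" "det P \<noteq> 0" and \<pi>: "\<pi> permutes {..<n}"
  shows "segment_flag n P \<pi> \<in> chambers (spherical_apartment n (basis_lines n (set (cols P))))"
    (is "?C \<in> chambers ?\<Sigma>")
proof -
  note seg = permutes_segment[OF \<pi>]
  have proper: "\<pi> ` {..<i} \<noteq> {}" "\<pi> ` {..<i} \<noteq> {..<n}" if "0 < i" "i < n" for i
    using seg(2)[of i] that by auto
  have "?C \<in> spherical_building n"
    unfolding spherical_building_def flag_complex_def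
  proof (intro CollectI conjI ballI)
    show "?C \<subseteq> proper_subspaces n"
      using frame_subspace_proper_iff[OF P] seg(1) proper by (auto simp: segment_flag_def)
    fix U W assume "U \<in> ?C" "W \<in> ?C"
    then obtain i j where ij: "i < n" "U = frame_subspace n P (\<pi> ` {..<i})"
        "j < n" "W = frame_subspace n P (\<pi> ` {..<j})"
      by (auto simp: segment_flag_def)
    have "\<pi> ` {..<i} \<subseteq> \<pi> ` {..<j} \<or> \<pi> ` {..<j} \<subseteq> \<pi> ` {..<i}"
      by (meson image_mono lessThan_subset_iff linear)
    thus "U \<subseteq> W \<or> W \<subseteq> U"
      using frame_subspace_subset_iff[OF P] seg(1) ij by (meson less_imp_le)
  qed (simp add: segment_flag_def)
  hence mem: "?C \<in> ?\<Sigma>"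
    unfolding mem_spherical_apartment_iff[OF P]
  proof (intro conjI ballI)
    fix W assume "W \<in> ?C"
    then obtain i where "i < n" "W = frame_subspace n P (\<pi> ` {..<i})"
      by (auto simp: segment_flag_def)
    thus "\<exists>J\<subseteq>{..<n}. W = frame_subspace n P J"
      using seg(1)[OF less_imp_le] by (intro exI[of _ "\<pi> ` {..<i}"]) simp
  qed
  have "\<sigma> \<subseteq> ?C" if \<sigma>: "\<sigma> \<in> ?\<Sigma>" "?C \<subseteq> \<sigma>" for \<sigma>
  proof
    fix W assume "W \<in> \<sigma>"
    then obtain J where J: "J \<subseteq> {..<n}" "W = frame_subspace n P J"
      using \<sigma>(1) mem_spherical_apartment_iff[OF P] by blast
    have "W \<in> proper_subspaces n"
      using \<sigma>(1) \<open>W \<in> \<sigma>\<close>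
      by (auto simp: mem_spherical_apartment_iff[OF P] spherical_building_def flag_complex_def)
    hence "J \<noteq> {}" "J \<noteq> {..<n}"
      using frame_subspace_proper_iff[OF P J(1)] J(2) by auto
    hence card: "0 < card J" "card J < n"
      using J(1) finite_subset[OF J(1)] psubset_card_mono[of "{..<n}" J] by (auto simp: card_gt_0_iff)
    let ?U = "frame_subspace n P (\<pi> ` {..<card J})"
    have "?U \<in> \<sigma>"
      using \<sigma>(2) card by (auto simp: segment_flag_def)
    hence "W \<subseteq> ?U \<or> ?U \<subseteq> W"
      using \<sigma>(1) \<open>W \<in> \<sigma>\<close>
      by (auto simp: mem_spherical_apartment_iff[OF P] spherical_building_def flag_complex_def)
    hence "J = \<pi> ` {..<card J}"
      using comparable_with_initial_segments[OF \<pi> J(1)] frame_subspace_subset_iff[OF P]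
        J seg(1)[of "card J"] card by auto
    thus "W \<in> ?C"
      using J(2) card unfolding segment_flag_def by (intro image_eqI[of _ _ "card J"]) simp_all
  qed
  thus ?thesis
    using mem by (auto simp: chambers_def)
qed

lemma coord_proj_in_coord_space:
  "x \<in> coord_space n J \<Longrightarrow> coord_proj n i x \<in> coord_space n J"
  by (auto simp: coord_space_def coord_proj_def)

lemma monomial_mat_image_coord_space:
  assumes \<sigma>: "\<sigma> permutes {..<n}" and c: "\<And>j. j < n \<Longrightarrow> c j \<noteq> 0"
  shows "mat_image (monomial_mat n \<sigma> c) (coord_space n J) = coord_space n (\<sigma> ` J)"
proof -
  have cart: "coord_space n J = {x \<in> carrier_vec n. \<forall>j<n. x $ j \<in> (if j \<in> J then UNIV else {0})}"
    for J :: "nat set"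
    by (auto simp: coord_space_def)
  show ?thesis
    unfolding cart by (rule monomial_mat_image_cartesian[OF \<sigma> c])
      (use c permutes_inj[OF \<sigma>] in \<open>auto simp: inj_image_mem_iff\<close>)
qed

text \<open>An element \<open>h\<close> that stabilises the apartment and moves the chamber of the identity ordering to
  that of \<open>\<pi>\<close> induces the permutation \<open>\<pi>\<close> of the frame. That \<open>h\<close> is monomial follows from stability
  under coordinate projections: \<open>h\<close> maps a line of the frame, which is a vertex for \<open>n \<ge> 2\<close>, to a
  subspace of the apartment.\<close>
theorem spherical_weakly_transitive_realises_all_permutations:
  fixes H :: "'k::field mat set"
  assumes "n \<ge> 2" and H: "\<And>h. h \<in> H \<Longrightarrow> h \<in> carrier_mat n n \<and> det h \<noteq> 0"
    and wt: "weakly_transitive mat_image H (spherical_apartments n)"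
  shows "realises_all_permutations n H"
proof -
  obtain P :: "'k mat" where P: "P \<in> carrier_mat n n" "det P \<noteq> 0"
    and trans: "chamber_transitive mat_image
      (stabilizer mat_image H (spherical_apartment n (basis_lines n (set (cols P)))))
      (spherical_apartment n (basis_lines n (set (cols P))))"
    using wt unfolding weakly_transitive_def spherical_apartments_def frames_def
    by (auto simp: basis_iff_cols_nonsingular)
  let ?\<Sigma> = "spherical_apartment n (basis_lines n (set (cols P)))"
  have "\<exists>h\<in>H. \<exists>c. h * P = P * monomial_mat n \<pi> c" if \<pi>: "\<pi> permutes {..<n}" for \<pi>
  proof -
    have "segment_flag n P id \<in> chambers ?\<Sigma>" "segment_flag n P \<pi> \<in> chambers ?\<Sigma>"
      using segment_flag_chamber[OF P] permutes_id \<pi> by auto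
    hence "\<exists>h\<in>stabilizer mat_image H ?\<Sigma>. mat_image h ` segment_flag n P id = segment_flag n P \<pi>"
      using trans unfolding chamber_transitive_def by simp
    then obtain h where h: "h \<in> H" and stab: "complex_image (mat_image h) ?\<Sigma> = ?\<Sigma>"
      and flag: "mat_image h ` segment_flag n P id = segment_flag n P \<pi>"
      by (auto simp: stabilizer_def)
    have hc: "h \<in> carrier_mat n n" "det h \<noteq> 0"
      using H[OF h] by auto
    obtain g where g: "g \<in> carrier_mat n n" "h * P = P * g" "det g = det h"
      using conjugate_matrix[OF P hc(1)] by blast
    have act: "mat_image h (mat_image P X) = mat_image P (mat_image g X)" if "X \<subseteq> carrier_vec n" for X
      using mat_image_mult[OF hc(1) P(1) that] mat_image_mult[OF P(1) g(1) that] g(2) by simp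
    have carrier: "mat_image g X \<subseteq> carrier_vec n" if "X \<subseteq> carrier_vec n" for X
      using that g(1) by (auto simp: mat_image_def)
    have "\<exists>a. coord_proj n i (col g j) = a \<cdot>\<^sub>v col g j" if "i < n" "j < n" for i j
    proof -
      have "{j} \<noteq> {..<n}"
proof
        assume "{j} = {..<n}"
        hence "card {j} = card {..<n}"
          by (rule arg_cong)
        thus False
          using \<open>n \<ge> 2\<close> by simp
      qed
      hence "{frame_subspace n P {j}} \<in> ?\<Sigma>"
        using frame_subspace_proper_iff[OF P, of "{j}"] \<open>j < n\<close>
        by (auto simp: mem_spherical_apartment_iff[OF P] spherical_building_def flag_complex_def)
      hence "mat_image h ` {frame_subspace n P {j}} \<in> complex_image (mat_image h) ?\<Sigma>"
        unfolding complex_image_def by (rule imageI)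
      hence "{mat_image h (frame_subspace n P {j})} \<in> ?\<Sigma>"
        by (simp add: stab)
      then obtain J where "mat_image h (frame_subspace n P {j}) = frame_subspace n P J"
        using mem_spherical_apartment_iff[OF P] by blast
      hence J: "mat_image g (coord_space n {j}) = coord_space n J"
        using act[OF coord_space_carrier] mat_image_eq_iff[OF P carrier[OF coord_space_carrier] coord_space_carrier]
        by metis
      have "col g j \<in> mat_image g (coord_space n {j})"
        using \<open>j < n\<close> unfolding mat_image_def
        by (intro image_eqI[of _ _ "unit_vec n j"])
          (simp_all add: mat_mult_unit_vec[OF g(1)] unit_vec_in_coord_space)
      hence "coord_proj n i (col g j) \<in> mat_image g (coord_space n {j})"
        unfolding J by (rule coord_proj_in_coord_space)
      then obtain x where x: "x \<in> coord_space n {j}" "coord_proj n i (col g j) = g *\<^sub>v x"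
        by (auto simp: mat_image_def)
      have "x = x $ j \<cdot>\<^sub>v unit_vec n j"
        using x(1) by (intro eq_vecI) (auto simp: coord_space_def unit_vec_def)
      hence "g *\<^sub>v x = x $ j \<cdot>\<^sub>v col g j"
        using mult_mat_vec[OF g(1) unit_vec_carrier] mat_mult_unit_vec[OF g(1) \<open>j < n\<close>] by metis
      thus ?thesis
        using x(2) by auto
    qed
    then obtain \<sigma> c where \<sigma>: "\<sigma> permutes {..<n}" and c: "\<And>j. j < n \<Longrightarrow> c j \<noteq> 0"
      and mono: "g = monomial_mat n \<sigma> c"
      using monomial_if_projections_on_column_lines[OF g(1)] g(3) hc(2) by metis
    have "\<sigma> ` {..<i} = \<pi> ` {..<i}" if "i < n" for i
    proof (cases "i = 0")
      case False
      have "frame_subspace n P {..<i} \<in> segment_flag n P id"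
        using False that by (auto simp: segment_flag_def)
      hence "mat_image h (frame_subspace n P {..<i}) \<in> segment_flag n P \<pi>"
        using flag by blast
      moreover have "mat_image h (frame_subspace n P {..<i}) = frame_subspace n P (\<sigma> ` {..<i})"
        by (simp add: act[OF coord_space_carrier] mono monomial_mat_image_coord_space[OF \<sigma> c])
      ultimately obtain i' where i': "i' < n"
          "frame_subspace n P (\<sigma> ` {..<i}) = frame_subspace n P (\<pi> ` {..<i'})"
        by (auto simp: segment_flag_def)
      have eq: "\<sigma> ` {..<i} = \<pi> ` {..<i'}"
        using frame_subspace_eq_iff[OF P permutes_segment(1)[OF \<sigma>] permutes_segment(1)[OF \<pi>]]
          i' that by (meson less_imp_le)
      hence "i = i'"
        using permutes_segment(2)[OF \<sigma>, of i] permutes_segment(2)[OF \<pi>, of i'] i'(1) that by simp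
      with eq show ?thesis
        by simp
    qed simp
    hence "\<sigma> = \<pi>"
      by (rule permutation_determined_by_initial_segments[OF \<sigma> \<pi>])
    thus ?thesis
      using h g(2) mono by auto
  qed
  thus ?thesis
    using P unfolding realises_all_permutations_def by blast
qed

section \<open>Lattices of a frame\<close>

lemma discrete_valuation_mult:
  "discrete_valuation v \<Longrightarrow> x \<noteq> 0 \<Longrightarrow> y \<noteq> 0 \<Longrightarrow> v (x * y) = v x + v y"
  by (simp add: discrete_valuation_def)

lemma discrete_valuation_one: "discrete_valuation v \<Longrightarrow> v 1 = 0"
  using discrete_valuation_mult[of v 1 1] by simp

lemma discrete_valuation_sign:
  assumes "discrete_valuation v"
  shows "v (signof p) = 0"
proof -
  have "v (- 1) + v (- 1) = v 1"
    using discrete_valuation_mult[OF assms, of "- 1" "- 1"] by simp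
  thus ?thesis
    using discrete_valuation_one[OF assms] signof_pm_one[of p, where ?'a = 'a] by auto
qed

lemma discrete_valuation_prod:
  assumes v: "discrete_valuation v" and "finite A" "\<And>j. j \<in> A \<Longrightarrow> c j \<noteq> 0"
  shows "v (\<Prod>j\<in>A. c j) = (\<Sum>j\<in>A. v (c j))"
  using assms(2,3)
  by (induction A rule: finite_induct)
    (simp_all add: discrete_valuation_one[OF v] discrete_valuation_mult[OF v])

lemma element_of_valuation:
  assumes "discrete_valuation v"
  obtains x where "x \<noteq> 0" "v x = m"
proof -
  have "m \<in> v ` (UNIV - {0})"
    using assms by (simp add: discrete_valuation_def)
  with that show ?thesis
    by auto
qed

lemma mult_mem_val_ball_iff:
  assumes v: "discrete_valuation v" and "c \<noteq> 0"
  shows "c * x \<in> val_ball v (v c + m) \<longleftrightarrow> x \<in> val_ball v m"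
  using discrete_valuation_mult[OF v \<open>c \<noteq> 0\<close>, of x] \<open>c \<noteq> 0\<close>
  by (cases "x = 0") (auto simp: val_ball_def)

text \<open>The lattice whose basis consists of the vectors \<open>p\<^sup>m e\<^sub>j\<close> with \<open>m = a j\<close>, for a uniformiser \<open>p\<close>;
  larger exponents give smaller lattices.\<close>
definition coord_lattice :: "('k::field \<Rightarrow> int) \<Rightarrow> nat \<Rightarrow> (nat \<Rightarrow> int) \<Rightarrow> 'k vec set" where
  "coord_lattice v n a = {x \<in> carrier_vec n. \<forall>j<n. x $ j \<in> val_ball v (a j)}"

abbreviation frame_lattice ::
  "('k::field \<Rightarrow> int) \<Rightarrow> nat \<Rightarrow> 'k mat \<Rightarrow> (nat \<Rightarrow> int) \<Rightarrow> 'k vec set" where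
  "frame_lattice v n P a \<equiv> mat_image P (coord_lattice v n a)"

lemma coord_lattice_carrier: "coord_lattice v n a \<subseteq> carrier_vec n"
  by (auto simp: coord_lattice_def)

lemma coord_lattice_subset_iff:
  assumes v: "discrete_valuation v"
  shows "coord_lattice v n a \<subseteq> coord_lattice v n a' \<longleftrightarrow> (\<forall>j<n. a' j \<le> a j)"
proof (intro iffI allI impI)
  fix j assume sub: "coord_lattice v n a \<subseteq> coord_lattice v n a'" and "j < n"
  obtain x where x: "x \<noteq> 0" "v x = a j"
    using element_of_valuation[OF v] .
  have "x \<cdot>\<^sub>v unit_vec n j \<in> coord_lattice v n a"
    using x \<open>j < n\<close> by (auto simp: coord_lattice_def val_ball_def unit_vec_def)
  with sub have "x \<cdot>\<^sub>v unit_vec n j \<in> coord_lattice v n a'"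
    by blast
  thus "a' j \<le> a j"
    using x \<open>j < n\<close> by (auto simp: coord_lattice_def val_ball_def unit_vec_def)
next
  assume "\<forall>j<n. a' j \<le> a j"
  thus "coord_lattice v n a \<subseteq> coord_lattice v n a'"
    by (force simp: coord_lattice_def val_ball_def)
qed

lemma frame_lattice_subset_iff:
  assumes v: "discrete_valuation v" and P: "P \<in> carrier_mat n n" "det P \<noteq> 0"
  shows "frame_lattice v n P a \<subseteq> frame_lattice v n P a' \<longleftrightarrow> (\<forall>j<n. a' j \<le> a j)"
  using mat_image_subset_iff[OF P coord_lattice_carrier coord_lattice_carrier]
    coord_lattice_subset_iff[OF v] by blast

lemma frame_lattice_eq_iff:
  assumes v: "discrete_valuation v" and P: "P \<in> carrier_mat n n" "det P \<noteq> 0"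
  shows "frame_lattice v n P a = frame_lattice v n P a' \<longleftrightarrow> (\<forall>j<n. a j = a' j)"
  unfolding set_eq_subset frame_lattice_subset_iff[OF v P] by (auto intro: order_antisym)

lemma coord_proj_in_coord_lattice:
  "x \<in> coord_lattice v n a \<Longrightarrow> coord_proj n i x \<in> coord_lattice v n a"
  by (auto simp: coord_lattice_def coord_proj_def val_ball_def)

lemma monomial_mat_image_coord_lattice:
  assumes v: "discrete_valuation v" and \<sigma>: "\<sigma> permutes {..<n}" and c: "\<And>j. j < n \<Longrightarrow> c j \<noteq> 0"
    and a': "\<And>j. j < n \<Longrightarrow> a' (\<sigma> j) = v (c j) + a j"
  shows "mat_image (monomial_mat n \<sigma> c) (coord_lattice v n a) = coord_lattice v n a'"
  unfolding coord_lattice_def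
  by (rule monomial_mat_image_cartesian[OF \<sigma> c])
    (simp_all add: a' mult_mem_val_ball_iff[OF v c])

text \<open>Scalar matrices are monomial, with the identity as permutation.\<close>
lemma scale_frame_lattice:
  assumes v: "discrete_valuation v" and P: "P \<in> carrier_mat n n" and c: "c \<noteq> 0"
  shows "(\<lambda>w. c \<cdot>\<^sub>v w) ` frame_lattice v n P a = frame_lattice v n P (\<lambda>j. v c + a j)"
proof -
  have "(\<lambda>w. c \<cdot>\<^sub>v w) ` frame_lattice v n P a = mat_image P ((\<lambda>x. c \<cdot>\<^sub>v x) ` coord_lattice v n a)"
    unfolding mat_image_def image_image
    using subsetD[OF coord_lattice_carrier, of _ v n a]
    by (intro image_cong) (simp_all add: mult_mat_vec[OF P])
  also have "(\<lambda>x. c \<cdot>\<^sub>v x) ` coord_lattice v n a = mat_image (monomial_mat n id (\<lambda>_. c)) (coord_lattice v n a)"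
    unfolding mat_image_def
  proof (intro image_cong refl)
    fix x assume "x \<in> coord_lattice v n a"
    hence x: "x \<in> carrier_vec n"
      using coord_lattice_carrier by blast
    show "c \<cdot>\<^sub>v x = monomial_mat n id (\<lambda>_. c) *\<^sub>v x"
    proof (rule eq_vecI)
      fix i assume "i < dim_vec (monomial_mat n id (\<lambda>_. c) *\<^sub>v x)"
      hence "i < n"
        by (simp add: monomial_mat_def)
      thus "(c \<cdot>\<^sub>v x) $ i = (monomial_mat n id (\<lambda>_. c) *\<^sub>v x) $ i"
        using monomial_mat_mult_vec[OF permutes_id x, of i] x by simp
    qed (use x in \<open>simp add: monomial_mat_def\<close>)
  qed
  also have "\<dots> = coord_lattice v n (\<lambda>j. v c + a j)"
    by (rule monomial_mat_image_coord_lattice[OF v permutes_id]) (use c in auto)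
  finally show ?thesis .
qed

text \<open>The vertices of the apartment of a frame form \<open>\<int>\<^sup>n\<close> modulo the diagonal \<open>\<int>\<close>, by the exponents of
  the lattices. The following lemmas express equality and incidence of vertices in these terms.\<close>
abbreviation frame_vertex ::
  "('k::field \<Rightarrow> int) \<Rightarrow> nat \<Rightarrow> 'k mat \<Rightarrow> (nat \<Rightarrow> int) \<Rightarrow> 'k vec set set" where
  "frame_vertex v n P a \<equiv> homothety_class (frame_lattice v n P a)"

lemma frame_vertex_eq_range:
  assumes v: "discrete_valuation v" and P: "P \<in> carrier_mat n n"
  shows "frame_vertex v n P a = range (\<lambda>k. frame_lattice v n P (\<lambda>j. k + a j))"
proof (intro equalityI subsetI)
  fix L assume "L \<in> frame_vertex v n P a"
  thus "L \<in> range (\<lambda>k. frame_lattice v n P (\<lambda>j. k + a j))"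
    using scale_frame_lattice[OF v P] by (auto simp: homothety_class_def)
next
  fix L assume "L \<in> range (\<lambda>k. frame_lattice v n P (\<lambda>j. k + a j))"
  then obtain k where k: "L = frame_lattice v n P (\<lambda>j. k + a j)"
    by blast
  obtain c where "c \<noteq> 0" "v c = k"
    using element_of_valuation[OF v] .
  thus "L \<in> frame_vertex v n P a"
    using scale_frame_lattice[OF v P, of c a] k by (auto simp: homothety_class_def)
qed

lemma frame_vertex_eq_iff:
  assumes v: "discrete_valuation v" and P: "P \<in> carrier_mat n n" "det P \<noteq> 0"
  shows "frame_vertex v n P a = frame_vertex v n P a' \<longleftrightarrow> (\<exists>k. \<forall>j<n. a' j = k + a j)"
proof
  assume "frame_vertex v n P a = frame_vertex v n P a'"
  moreover have "frame_lattice v n P (\<lambda>j. 0 + a' j) \<in> frame_vertex v n P a'"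
    unfolding frame_vertex_eq_range[OF v P(1)] by (rule rangeI)
  ultimately have "frame_lattice v n P (\<lambda>j. 0 + a' j) \<in> frame_vertex v n P a"
    by simp
  thus "\<exists>k. \<forall>j<n. a' j = k + a j"
    by (auto simp: frame_vertex_eq_range[OF v P(1)] frame_lattice_eq_iff[OF v P])
next
  assume "\<exists>k. \<forall>j<n. a' j = k + a j"
  then obtain k where k: "\<forall>j<n. a' j = k + a j"
    by blast
  have "frame_lattice v n P (\<lambda>j. l + a j) \<in> range (\<lambda>k. frame_lattice v n P (\<lambda>j. k + a' j))" for l
    using k by (intro range_eqI[of _ _ "l - k"]) (simp add: frame_lattice_eq_iff[OF v P])
  moreover have "frame_lattice v n P (\<lambda>j. l + a' j) \<in> range (\<lambda>k. frame_lattice v n P (\<lambda>j. k + a j))" for l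
    using k by (intro range_eqI[of _ _ "l + k"]) (simp add: frame_lattice_eq_iff[OF v P])
  ultimately show "frame_vertex v n P a = frame_vertex v n P a'"
    unfolding frame_vertex_eq_range[OF v P(1)] by blast
qed

lemma lattice_incident_frame_vertex_iff:
  assumes v: "discrete_valuation v" and P: "P \<in> carrier_mat n n" "det P \<noteq> 0"
  shows "lattice_incident v (frame_vertex v n P a) (frame_vertex v n P a') \<longleftrightarrow>
    (\<exists>k. \<forall>j<n. a j \<le> k + a' j \<and> k + a' j \<le> a j + 1)"
proof
  assume "lattice_incident v (frame_vertex v n P a) (frame_vertex v n P a')"
  then obtain k l \<pi> where \<pi>: "\<pi> \<noteq> 0" "v \<pi> = 1"
    "(\<lambda>w. \<pi> \<cdot>\<^sub>v w) ` frame_lattice v n P (\<lambda>j. k + a j) \<subseteq> frame_lattice v n P (\<lambda>j. l + a' j)"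
    "frame_lattice v n P (\<lambda>j. l + a' j) \<subseteq> frame_lattice v n P (\<lambda>j. k + a j)"
    unfolding lattice_incident_def frame_vertex_eq_range[OF v P(1)] by blast
  have "\<forall>j<n. a j \<le> (l - k) + a' j \<and> (l - k) + a' j \<le> a j + 1"
    using \<pi>(3,4) by (auto simp: scale_frame_lattice[OF v P(1) \<pi>(1)] frame_lattice_subset_iff[OF v P] \<pi>(2))
  thus "\<exists>k. \<forall>j<n. a j \<le> k + a' j \<and> k + a' j \<le> a j + 1"
    by blast
next
  assume "\<exists>k. \<forall>j<n. a j \<le> k + a' j \<and> k + a' j \<le> a j + 1"
  then obtain k where k: "\<forall>j<n. a j \<le> k + a' j \<and> k + a' j \<le> a j + 1"
    by blast
  obtain \<pi> where \<pi>: "\<pi> \<noteq> 0" "v \<pi> = 1"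
    using element_of_valuation[OF v] .
  have "frame_lattice v n P (\<lambda>j. 0 + a j) \<in> frame_vertex v n P a"
    "frame_lattice v n P (\<lambda>j. k + a' j) \<in> frame_vertex v n P a'"
    unfolding frame_vertex_eq_range[OF v P(1)] by (rule rangeI)+
  moreover have "(\<lambda>w. \<pi> \<cdot>\<^sub>v w) ` frame_lattice v n P (\<lambda>j. 0 + a j) \<subseteq> frame_lattice v n P (\<lambda>j. k + a' j)"
    "frame_lattice v n P (\<lambda>j. k + a' j) \<subseteq> frame_lattice v n P (\<lambda>j. 0 + a j)"
    using k by (auto simp: scale_frame_lattice[OF v P(1) \<pi>(1)] frame_lattice_subset_iff[OF v P] \<pi>(2))
  ultimately show "lattice_incident v (frame_vertex v n P a) (frame_vertex v n P a')"
    unfolding lattice_incident_def using \<pi> by blast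
qed

section \<open>Apartments of the affine building\<close>

lemma lattice_span_cols:
  fixes Q :: "'k::field mat"
  assumes Q: "Q \<in> carrier_mat n n" "det Q \<noteq> 0"
  shows "lattice_span v n (set (cols Q)) = frame_lattice v n Q (\<lambda>_. 0)"
proof -
  have inj: "inj_on (col Q) {..<n}"
    using nonsingular_cols_not_proportional[OF Q, of _ _ 1 1] by (intro inj_onI) auto
  have "lattice_span v n (set (cols Q))
    = {Q *\<^sub>v vec n (\<lambda>j. if j \<in> {..<n} then a (col Q j) else 0) | a. a ` col Q ` {..<n} \<subseteq> val_ball v 0}"
    unfolding lattice_span_def cols_as_image[OF Q(1)] lincomb_cols_eq_mult_mat_vec[OF Q subset_refl] ..
  also have "\<dots> = frame_lattice v n Q (\<lambda>_. 0)"
  proof (intro equalityI subsetI)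
    fix w assume "w \<in> frame_lattice v n Q (\<lambda>_. 0)"
    then obtain x where x: "x \<in> coord_lattice v n (\<lambda>_. 0)" "w = Q *\<^sub>v x"
      by (auto simp: mat_image_def)
    define a where "a = (\<lambda>b. x $ the_inv_into {..<n} (col Q) b)"
    have a: "a (col Q j) = x $ j" if "j < n" for j
      using the_inv_into_f_f[OF inj] that by (simp add: a_def)
    have "x = vec n (\<lambda>j. if j \<in> {..<n} then a (col Q j) else 0)"
      using x(1) by (intro eq_vecI) (auto simp: a coord_lattice_def)
    moreover have "a ` col Q ` {..<n} \<subseteq> val_ball v 0"
      using x(1) by (auto simp: a coord_lattice_def)
    ultimately show "w \<in> {Q *\<^sub>v vec n (\<lambda>j. if j \<in> {..<n} then a (col Q j) else 0) | a.
        a ` col Q ` {..<n} \<subseteq> val_ball v 0}"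
      using x(2) by blast
  next
    fix w assume "w \<in> {Q *\<^sub>v vec n (\<lambda>j. if j \<in> {..<n} then a (col Q j) else 0) | a.
        a ` col Q ` {..<n} \<subseteq> val_ball v 0}"
    then obtain a where a: "w = Q *\<^sub>v vec n (\<lambda>j. if j \<in> {..<n} then a (col Q j) else 0)"
        "a ` col Q ` {..<n} \<subseteq> val_ball v 0"
      by blast
    have "vec n (\<lambda>j. if j \<in> {..<n} then a (col Q j) else 0) \<in> coord_lattice v n (\<lambda>_. 0)"
      using a(2) by (auto simp: coord_lattice_def)
    thus "w \<in> frame_lattice v n Q (\<lambda>_. 0)"
      using a(1) by (simp add: mat_image_def)
  qed
  finally show ?thesis .
qed

text \<open>The required basis consists of multiples of the columns of \<open>P\<close> by scalars of the prescribed
  valuations.\<close>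
lemma frame_vertex_of_adapted_basis:
  fixes P :: "'k::field mat"
  assumes v: "discrete_valuation v" and P: "P \<in> carrier_mat n n" "det P \<noteq> 0"
  obtains B where "vectorspace.basis class_ring (vec_sp n) B"
    "basis_lines n B = basis_lines n (set (cols P))"
    "frame_vertex v n P a = homothety_class (lattice_span v n B)"
proof -
  have "\<forall>j. \<exists>x. x \<noteq> 0 \<and> v x = a j"
    using element_of_valuation[OF v] by metis
  then obtain u where u: "\<And>j. u j \<noteq> 0" "\<And>j. v (u j) = a j"
    by metis
  let ?M = "monomial_mat n id u"
  let ?Q = "P * ?M"
  have "det ?M \<noteq> 0"
    using u(1) by (simp add: det_monomial_mat[OF permutes_id])
  hence Q: "?Q \<in> carrier_mat n n" "det ?Q \<noteq> 0"
    using P by (simp_all add: det_mult[OF P(1) monomial_mat_closed])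
  have "frame_subspace n ?Q {j} = frame_subspace n P {j}" for j
    using mat_image_mult[OF P(1) monomial_mat_closed coord_space_carrier]
      monomial_mat_image_coord_space[OF permutes_id, of n u "{j}"] u(1) by simp
  hence lines: "basis_lines n (set (cols ?Q)) = basis_lines n (set (cols P))"
    by (simp add: basis_lines_cols[OF Q] basis_lines_cols[OF P])
  have "mat_image ?M (coord_lattice v n (\<lambda>_. 0)) = coord_lattice v n a"
    by (rule monomial_mat_image_coord_lattice[OF v permutes_id]) (use u in auto)
  hence "lattice_span v n (set (cols ?Q)) = frame_lattice v n P a"
    using mat_image_mult[OF P(1) monomial_mat_closed coord_lattice_carrier]
    by (simp add: lattice_span_cols[OF Q])
  with lines show ?thesis
    using that[of "set (cols ?Q)"] Q by (auto simp: basis_iff_cols_nonsingular)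
qed

text \<open>A basis on the same lines differs from the columns of \<open>P\<close> by a monomial matrix, and the
  valuations of its entries are the exponents.\<close>
lemma adapted_basis_frame_vertex:
  fixes P :: "'k::field mat"
  assumes v: "discrete_valuation v" and P: "P \<in> carrier_mat n n" "det P \<noteq> 0"
    and B: "vectorspace.basis class_ring (vec_sp n) B"
    and lines: "basis_lines n B = basis_lines n (set (cols P))"
  obtains a where "lattice_span v n B = frame_lattice v n P a"
proof -
  obtain Q where Q: "Q \<in> carrier_mat n n" "det Q \<noteq> 0" "set (cols Q) = B"
    using B by (auto simp: basis_iff_cols_nonsingular)
  obtain g where g: "g \<in> carrier_mat n n" "Q * 1\<^sub>m n = P * g"
  proof -
    obtain R where R: "R \<in> carrier_mat n n" "P * R = 1\<^sub>m n"
      using nonsingular_inverse[OF P] by blast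
    have "P * (R * Q) = Q"
      using assoc_mult_mat[OF P(1) R(1) Q(1)] R(2) Q(1) by simp
    thus ?thesis
      using that[of "R * Q"] R(1) Q(1) by simp
  qed
  hence Qg: "Q = P * g"
    using Q(1) by simp
  have "det P * det g = det Q"
    using det_mult[OF P(1) g(1)] Qg by simp
  hence "det g \<noteq> 0"
    using Q(2) by auto
  have "\<exists>b. coord_proj n i (col g j) = b \<cdot>\<^sub>v col g j" if ij: "i < n" "j < n" for i j
  proof -
    have "frame_subspace n Q {j} \<in> basis_lines n (set (cols P))"
      using lines Q(3) ij(2) basis_lines_cols[OF Q(1,2)] by auto
    then obtain s where "frame_subspace n Q {j} = frame_subspace n P {s}"
      by (auto simp: basis_lines_cols[OF P])
    hence "mat_image P (mat_image g (coord_space n {j})) = mat_image P (coord_space n {s})"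
      using mat_image_mult[OF P(1) g(1) coord_space_carrier] Qg by simp
    moreover have "mat_image g (coord_space n {j}) \<subseteq> carrier_vec n"
      using mat_image_carrier[OF g(1) coord_space_carrier] .
    ultimately have "mat_image g (coord_space n {j}) = coord_space n {s}"
      using mat_image_eq_iff[OF P _ coord_space_carrier] by simp
    moreover have "col g j \<in> mat_image g (coord_space n {j})"
      using ij unfolding mat_image_def
      by (intro image_eqI[of _ _ "unit_vec n j"])
        (simp_all add: mat_mult_unit_vec[OF g(1)] unit_vec_in_coord_space)
    ultimately have "col g j \<in> coord_space n {s}"
      by simp
    hence "coord_proj n i (col g j) = (if i = s then 1 else 0) \<cdot>\<^sub>v col g j"
      using ij g(1) by (intro eq_vecI) (auto simp: coord_proj_def coord_space_def)
    thus ?thesis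
      by blast
  qed
  then obtain \<sigma> u where \<sigma>: "\<sigma> permutes {..<n}" and u: "\<And>j. j < n \<Longrightarrow> u j \<noteq> 0"
    and mono: "g = monomial_mat n \<sigma> u"
    using monomial_if_projections_on_column_lines[OF g(1) \<open>det g \<noteq> 0\<close>] by metis
  define a where "a = (\<lambda>i. v (u (inv_into UNIV \<sigma> i)))"
  have "mat_image g (coord_lattice v n (\<lambda>_. 0)) = coord_lattice v n a"
    unfolding mono
    by (rule monomial_mat_image_coord_lattice[OF v \<sigma> u])
      (simp_all add: a_def permutes_inverses(2)[OF \<sigma>])
  hence "lattice_span v n B = frame_lattice v n P a"
    using lattice_span_cols[OF Q(1,2)] mat_image_mult[OF P(1) g(1) coord_lattice_carrier] Qg Q(3)
    by simp
  thus ?thesis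
    by (rule that)
qed

lemma mem_affine_apartment_iff:
  fixes P :: "'k::field mat"
  assumes v: "discrete_valuation v" and P: "P \<in> carrier_mat n n" "det P \<noteq> 0"
  shows "\<sigma> \<in> affine_apartment v n (basis_lines n (set (cols P))) \<longleftrightarrow>
    \<sigma> \<in> affine_building v n \<and> (\<forall>\<Lambda>\<in>\<sigma>. \<exists>a. \<Lambda> = frame_vertex v n P a)"
proof -
  have "(\<exists>B. vectorspace.basis class_ring (vec_sp n) B \<and> basis_lines n B = basis_lines n (set (cols P)) \<and>
      \<Lambda> = homothety_class (lattice_span v n B)) \<longleftrightarrow> (\<exists>a. \<Lambda> = frame_vertex v n P a)" (is "?l \<longleftrightarrow> ?r") for \<Lambda>
  proof
    assume ?l
    then obtain B where B: "vectorspace.basis class_ring (vec_sp n) B"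
        "basis_lines n B = basis_lines n (set (cols P))" "\<Lambda> = homothety_class (lattice_span v n B)"
      by blast
    obtain a where "lattice_span v n B = frame_lattice v n P a"
      using adapted_basis_frame_vertex[OF v P B(1,2)] .
    with B(3) show ?r
      by auto
  next
    assume ?r
    then obtain a where a: "\<Lambda> = frame_vertex v n P a"
      by blast
    obtain B where "vectorspace.basis class_ring (vec_sp n) B"
        "basis_lines n B = basis_lines n (set (cols P))"
        "frame_vertex v n P a = homothety_class (lattice_span v n B)"
      using frame_vertex_of_adapted_basis[OF v P] .
    with a show ?l
      by blast
  qed
  thus ?thesis
    by (simp add: affine_apartment_def)
qed

lemma frame_vertex_in_lattice_vertices:
  fixes P :: "'k::field mat"
  assumes v: "discrete_valuation v" and P: "P \<in> carrier_mat n n" "det P \<noteq> 0"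
  shows "frame_vertex v n P a \<in> lattice_vertices v n"
proof -
  obtain B where "vectorspace.basis class_ring (vec_sp n) B"
      "frame_vertex v n P a = homothety_class (lattice_span v n B)"
    using frame_vertex_of_adapted_basis[OF v P] .
  thus ?thesis
    by (auto simp: lattice_vertices_def)
qed

text \<open>The lattices with these exponents, for \<open>i = 0, \<dots>, n - 1\<close>, descend from the lattice spanned by
  the columns of \<open>P\<close> by multiplying the columns by a uniformiser one after the other, in the order
  \<open>\<pi> 0, \<pi> 1, \<dots>\<close>. The step \<open>i = n\<close> would lead back to the homothety class for \<open>i = 0\<close>.\<close>
definition segment_exponent :: "(nat \<Rightarrow> nat) \<Rightarrow> nat \<Rightarrow> nat \<Rightarrow> int" where
  "segment_exponent \<pi> i j = (if j \<in> \<pi> ` {..<i} then 1 else 0)"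

definition segment_lattices ::
  "('k::field \<Rightarrow> int) \<Rightarrow> nat \<Rightarrow> 'k mat \<Rightarrow> (nat \<Rightarrow> nat) \<Rightarrow> 'k vec set set set" where
  "segment_lattices v n P \<pi> = (\<lambda>i. frame_vertex v n P (segment_exponent \<pi> i)) ` {..<n}"

text \<open>A vertex incident with the base lattice is given by exponents \<open>0\<close> and \<open>1\<close> only, that is, by a
  set of indices. As in the spherical case, incidence with the remaining lattices of the chain
  makes this set comparable with the initial segments.\<close>
lemma segment_lattices_chamber:
  fixes P :: "'k::field mat"
  assumes v: "discrete_valuation v" and P: "P \<in> carrier_mat n n" "det P \<noteq> 0"
    and "n > 0" and \<pi>: "\<pi> permutes {..<n}"
  shows "segment_lattices v n P \<pi> \<in> chambers (affine_apartment v n (basis_lines n (set (cols P))))"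
    (is "?C \<in> chambers ?\<Sigma>")
proof -
  note seg = permutes_segment[OF \<pi>]
  note incident = lattice_incident_frame_vertex_iff[OF v P]
  have "?C \<in> affine_building v n"
    unfolding affine_building_def flag_complex_def
  proof (intro CollectI conjI ballI)
    fix \<Lambda> \<Lambda>' assume "\<Lambda> \<in> ?C" "\<Lambda>' \<in> ?C"
    then obtain i i' where \<Lambda>: "\<Lambda> = frame_vertex v n P (segment_exponent \<pi> i)"
        "\<Lambda>' = frame_vertex v n P (segment_exponent \<pi> i')"
      by (auto simp: segment_lattices_def)
    show "lattice_incident v \<Lambda> \<Lambda>'"
    proof (cases "i \<le> i'")
      case True
      hence "\<pi> ` {..<i} \<subseteq> \<pi> ` {..<i'}"
        by (intro image_mono) auto
      thus ?thesis
        unfolding \<Lambda> incident by (intro exI[of _ 0]) (auto simp: segment_exponent_def)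
    next
      case False
      hence "\<pi> ` {..<i'} \<subseteq> \<pi> ` {..<i}"
        by (intro image_mono) auto
      thus ?thesis
        unfolding \<Lambda> incident by (intro exI[of _ 1]) (auto simp: segment_exponent_def)
    qed
  qed (auto simp: segment_lattices_def frame_vertex_in_lattice_vertices[OF v P])
  hence mem: "?C \<in> ?\<Sigma>"
    by (auto simp: mem_affine_apartment_iff[OF v P] segment_lattices_def)
  have "\<sigma> \<subseteq> ?C" if \<sigma>: "\<sigma> \<in> ?\<Sigma>" "?C \<subseteq> \<sigma>" for \<sigma>
  proof
    fix \<Lambda> assume \<Lambda>: "\<Lambda> \<in> \<sigma>"
    then obtain a where a: "\<Lambda> = frame_vertex v n P a"
      using \<sigma>(1) mem_affine_apartment_iff[OF v P] by blast
    have adjacent: "lattice_incident v (frame_vertex v n P (segment_exponent \<pi> i)) \<Lambda>" if "i < n" for i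
    proof -
      have "frame_vertex v n P (segment_exponent \<pi> i) \<in> \<sigma>"
        using \<sigma>(2) that by (auto simp: segment_lattices_def)
      thus ?thesis
        using \<sigma>(1) \<Lambda> by (auto simp: mem_affine_apartment_iff[OF v P] affine_building_def flag_complex_def)
    qed
    obtain k where k: "\<forall>j<n. 0 \<le> k + a j \<and> k + a j \<le> 1"
      using adjacent[OF \<open>n > 0\<close>] by (auto simp: a incident segment_exponent_def)
    define J where "J = {j. j < n \<and> k + a j = 1}"
    have J: "J \<subseteq> {..<n}"
      by (auto simp: J_def)
    have exponent: "k + a j = (if j \<in> J then 1 else 0)" if "j < n" for j
      using k that unfolding J_def by (auto simp: order_le_less)
    \<comment> \<open>If \<open>J\<close> contains all indices, then the lattice is homothetic to the base lattice.\<close>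
    show "\<Lambda> \<in> ?C"
    proof (cases "card J < n")
      case False
      hence "J = {..<n}"
        using J card_subset_eq[of "{..<n}" J] card_mono[of "{..<n}" J] by simp
      hence "\<forall>j<n. segment_exponent \<pi> 0 j = (k - 1) + a j"
        using exponent by (simp add: segment_exponent_def algebra_simps)
      hence "\<Lambda> = frame_vertex v n P (segment_exponent \<pi> 0)"
        unfolding a frame_vertex_eq_iff[OF v P] by blast
      thus ?thesis
        using \<open>n > 0\<close> by (auto simp: segment_lattices_def)
    next
      case True
      let ?U = "\<pi> ` {..<card J}"
      obtain l where l: "\<forall>j<n. segment_exponent \<pi> (card J) j \<le> l + a j \<and>
          l + a j \<le> segment_exponent \<pi> (card J) j + 1"
        using adjacent[OF True] by (auto simp: a incident)
      have "J \<subseteq> ?U \<or> ?U \<subseteq> J"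
      proof (rule ccontr)
        assume "\<not> ?thesis"
        then obtain i j where ij: "i \<in> J" "i \<notin> ?U" "j \<in> ?U" "j \<notin> J"
          by blast
        hence "i < n" "j < n"
          using J seg(1)[of "card J"] True by auto
        thus False
          using l[rule_format, of i] l[rule_format, of j] exponent[of i] exponent[of j] ij
          by (simp add: segment_exponent_def)
      qed
      hence "J = ?U"
        by (rule comparable_with_initial_segments[OF \<pi> J])
      hence "\<forall>j<n. segment_exponent \<pi> (card J) j = k + a j"
        using exponent by (simp add: segment_exponent_def)
      hence "\<Lambda> = frame_vertex v n P (segment_exponent \<pi> (card J))"
        unfolding a frame_vertex_eq_iff[OF v P] by blast
      thus ?thesis
        using True by (auto simp: segment_lattices_def)
    qed
  qed
  thus ?thesis
    using mem by (auto simp: chambers_def)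
qed

text \<open>As in the spherical case, with two differences. A line of the frame is no longer a vertex, but
  it is spanned by the intersection of the lattices with exponent \<open>0\<close> on this line and \<open>N\<close> on the
  other lines, for all \<open>N\<close>. And \<open>h\<close> could a priori rotate the types of the vertices of a chamber;
  this is excluded by comparing sums of exponents, which change by the valuation of \<open>det h\<close>,
  here \<open>0\<close>.\<close>
theorem affine_weakly_transitive_realises_all_permutations:
  fixes H :: "'k::field mat set"
  assumes "n > 0" and v: "discrete_valuation v"
    and H: "\<And>h. h \<in> H \<Longrightarrow> h \<in> carrier_mat n n \<and> det h = 1"
    and wt: "weakly_transitive class_image H (affine_apartments v n)"
  shows "realises_all_permutations n H"
proof -
  obtain P :: "'k mat" where P: "P \<in> carrier_mat n n" "det P \<noteq> 0"
    and trans: "chamber_transitive class_image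
      (stabilizer class_image H (affine_apartment v n (basis_lines n (set (cols P)))))
      (affine_apartment v n (basis_lines n (set (cols P))))"
    using wt unfolding weakly_transitive_def affine_apartments_def frames_def
    by (auto simp: basis_iff_cols_nonsingular)
  let ?\<Sigma> = "affine_apartment v n (basis_lines n (set (cols P)))"
  have "\<exists>h\<in>H. \<exists>c. h * P = P * monomial_mat n \<pi> c" if \<pi>: "\<pi> permutes {..<n}" for \<pi>
  proof -
    have "segment_lattices v n P id \<in> chambers ?\<Sigma>" "segment_lattices v n P \<pi> \<in> chambers ?\<Sigma>"
      using segment_lattices_chamber[OF v P \<open>n > 0\<close>] permutes_id \<pi> by auto
    hence "\<exists>h\<in>stabilizer class_image H ?\<Sigma>.
        class_image h ` segment_lattices v n P id = segment_lattices v n P \<pi>"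
      using trans unfolding chamber_transitive_def by simp
    then obtain h where h: "h \<in> H" and stab: "complex_image (class_image h) ?\<Sigma> = ?\<Sigma>"
      and flag: "class_image h ` segment_lattices v n P id = segment_lattices v n P \<pi>"
      by (auto simp: stabilizer_def)
    have hc: "h \<in> carrier_mat n n" "det h = 1"
      using H[OF h] by auto
    obtain g where g: "g \<in> carrier_mat n n" "h * P = P * g" "det g = det h"
      using conjugate_matrix[OF P hc(1)] by blast
    have act: "mat_image h (frame_lattice v n P a) = mat_image P (mat_image g (coord_lattice v n a))" for a
      using mat_image_mult[OF hc(1) P(1) coord_lattice_carrier]
        mat_image_mult[OF P(1) g(1) coord_lattice_carrier] g(2) by simp
    have carrier: "mat_image g (coord_lattice v n a) \<subseteq> carrier_vec n" for a
      using mat_image_carrier[OF g(1) coord_lattice_carrier] .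
    have lattice_in_class: "mat_image h (frame_lattice v n P a) \<in> class_image h (frame_vertex v n P a)" for a
      unfolding class_image_def frame_vertex_eq_range[OF v P(1)]
      by (intro imageI range_eqI[of _ _ 0]) simp
    have lattice_image: "\<exists>a'. mat_image g (coord_lattice v n a) = coord_lattice v n a'" for a
    proof -
      have "lattice_incident v (frame_vertex v n P a) (frame_vertex v n P a)"
        unfolding lattice_incident_frame_vertex_iff[OF v P] by (intro exI[of _ 0]) simp
      hence "{frame_vertex v n P a} \<in> ?\<Sigma>"
        using frame_vertex_in_lattice_vertices[OF v P]
        by (auto simp: mem_affine_apartment_iff[OF v P] affine_building_def flag_complex_def)
      hence "class_image h ` {frame_vertex v n P a} \<in> complex_image (class_image h) ?\<Sigma>"
        unfolding complex_image_def by (rule imageI)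
      hence "{class_image h (frame_vertex v n P a)} \<in> ?\<Sigma>"
        by (simp add: stab)
      then obtain b where "class_image h (frame_vertex v n P a) = frame_vertex v n P b"
        using mem_affine_apartment_iff[OF v P] by blast
      with lattice_in_class[of a] obtain k where
        "mat_image P (mat_image g (coord_lattice v n a)) = frame_lattice v n P (\<lambda>j. k + b j)"
        unfolding frame_vertex_eq_range[OF v P(1)] act by blast
      thus ?thesis
        using mat_image_eq_iff[OF P carrier coord_lattice_carrier] by blast
    qed
    have "\<exists>a. coord_proj n i (col g j) = a \<cdot>\<^sub>v col g j" if ij: "i < n" "j < n" for i j
    proof -
      \<comment> \<open>The line spanned by the \<open>j\<close>-th basis vector is approximated by the lattices with exponents
        \<open>E N\<close>.\<close>
      define E where "E = (\<lambda>(N::nat) k. if k = j then 0 else int N)"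
      have "coord_proj n i (col g j) \<in> mat_image g (coord_lattice v n (E N))" for N
      proof -
        have "unit_vec n j \<in> coord_lattice v n (E N)"
          using discrete_valuation_one[OF v]
          by (auto simp: coord_lattice_def E_def val_ball_def unit_vec_def)
        hence "col g j \<in> mat_image g (coord_lattice v n (E N))"
          using mat_mult_unit_vec[OF g(1) ij(2)] unfolding mat_image_def by (metis imageI)
        thus ?thesis
          using lattice_image[of "E N"] coord_proj_in_coord_lattice by metis
      qed
      hence "\<forall>N. \<exists>x. x \<in> coord_lattice v n (E N) \<and> coord_proj n i (col g j) = g *\<^sub>v x"
        by (auto simp: mat_image_def)
      then obtain x where x: "\<And>N. x N \<in> coord_lattice v n (E N)"
          "\<And>N. coord_proj n i (col g j) = g *\<^sub>v x N"
        by metis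
      have "inj_on (\<lambda>x. g *\<^sub>v x) (carrier_vec n)"
        using inj_on_nonsingular[OF g(1)] g(3) hc(2) by simp
      hence const: "x N = x 0" for N
        using x subsetD[OF coord_lattice_carrier] by (metis inj_onD)
      have "x 0 $ k = 0" if k: "k < n" "k \<noteq> j" for k
      proof (rule ccontr)
        assume "x 0 $ k \<noteq> 0"
        moreover have "x 0 $ k \<in> val_ball v (int N)" for N
          using x(1)[of N] const[of N] k by (auto simp: coord_lattice_def E_def)
        ultimately have "int N \<le> v (x 0 $ k)" for N
          by (auto simp: val_ball_def)
        from this[of "nat (v (x 0 $ k) + 1)"] show False
          by linarith
      qed
      moreover have "x 0 \<in> carrier_vec n"
        using x(1) coord_lattice_carrier by blast
      ultimately have "x 0 = x 0 $ j \<cdot>\<^sub>v unit_vec n j"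
        by (intro eq_vecI) (auto simp: unit_vec_def)
      hence "g *\<^sub>v x 0 = x 0 $ j \<cdot>\<^sub>v col g j"
        using mult_mat_vec[OF g(1) unit_vec_carrier] mat_mult_unit_vec[OF g(1) ij(2)] by metis
      thus ?thesis
        using x(2)[of 0] by auto
    qed
    then obtain \<sigma> c where \<sigma>: "\<sigma> permutes {..<n}" and c: "\<And>j. j < n \<Longrightarrow> c j \<noteq> 0"
      and mono: "g = monomial_mat n \<sigma> c"
      using monomial_if_projections_on_column_lines[OF g(1)] g(3) hc(2) by (metis zero_neq_one)
    have "signof \<sigma> * (\<Prod>j<n. c j) = 1"
      using det_monomial_mat[OF \<sigma>, of c] mono g(3) hc(2) by simp
    moreover from this have "(signof \<sigma> :: 'k) \<noteq> 0" "(\<Prod>j<n. c j) \<noteq> 0"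
      by (metis mult_zero_left zero_neq_one, metis mult_zero_right zero_neq_one)
    ultimately have "v (signof \<sigma>) + v (\<Prod>j<n. c j) = v 1"
      using discrete_valuation_mult[OF v] by metis
    hence total: "(\<Sum>j<n. v (c j)) = 0"
      using discrete_valuation_prod[OF v, of "{..<n}" c] c
      by (simp add: discrete_valuation_sign[OF v] discrete_valuation_one[OF v])
    \<comment> \<open>\<open>h\<close> takes the \<open>i\<close>-th lattice of the first chain to a multiple of the \<open>i'\<close>-th one of the second
      by an element of valuation \<open>k\<close>; summing exponents gives \<open>i = n * k + i'\<close> with \<open>i, i' < n\<close>.\<close>
    have step: "v (c j) + segment_exponent id i j = segment_exponent \<pi> i (\<sigma> j)"
      if ij: "i < n" "j < n" for i j
    proof -
      define a' where "a' = (\<lambda>l. v (c (inv_into UNIV \<sigma> l)) + segment_exponent id i (inv_into UNIV \<sigma> l))"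
      have a': "a' (\<sigma> j) = v (c j) + segment_exponent id i j" for j
        by (simp add: a'_def permutes_inverses(2)[OF \<sigma>])
      have "frame_vertex v n P (segment_exponent id i) \<in> segment_lattices v n P id"
        using ij by (auto simp: segment_lattices_def)
      hence "class_image h (frame_vertex v n P (segment_exponent id i)) \<in> segment_lattices v n P \<pi>"
        using flag by blast
      then obtain i' where i': "i' < n" "class_image h (frame_vertex v n P (segment_exponent id i))
          = frame_vertex v n P (segment_exponent \<pi> i')"
        by (auto simp: segment_lattices_def)
      have "mat_image g (coord_lattice v n (segment_exponent id i)) = coord_lattice v n a'"
        unfolding mono by (rule monomial_mat_image_coord_lattice[OF v \<sigma> c]) (simp_all add: a')
      hence "frame_lattice v n P a' \<in> frame_vertex v n P (segment_exponent \<pi> i')"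
        using lattice_in_class[of "segment_exponent id i"] i'(2) by (simp add: act)
      then obtain k where "frame_lattice v n P a' = frame_lattice v n P (\<lambda>l. k + segment_exponent \<pi> i' l)"
        unfolding frame_vertex_eq_range[OF v P(1)] by blast
      hence "\<forall>l<n. a' l = k + segment_exponent \<pi> i' l"
        by (simp add: frame_lattice_eq_iff[OF v P])
      hence k: "v (c j) + segment_exponent id i j = k + segment_exponent \<pi> i' (\<sigma> j)" if "j < n" for j
        using a'[of j] permutes_in_image[OF \<sigma>, of j] that by simp
      have sum_exponent: "(\<Sum>j<n. segment_exponent \<rho> m j) = int m"
        if "\<rho> permutes {..<n}" "m < n" for \<rho> m
      proof -
        have "(\<Sum>j<n. segment_exponent \<rho> m j) = (\<Sum>j\<in>\<rho> ` {..<m}. 1)"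
          unfolding segment_exponent_def
          using permutes_segment(1)[OF that(1) less_imp_le[OF that(2)]]
          by (simp add: sum.inter_restrict[symmetric] Int_absorb1)
        thus ?thesis
          using permutes_segment(2)[OF that(1) less_imp_le[OF that(2)]] by simp
      qed
      have "(\<Sum>j<n. v (c j) + segment_exponent id i j) = (\<Sum>j<n. k + segment_exponent \<pi> i' (\<sigma> j))"
        using k by (intro sum.cong) auto
      moreover have "(\<Sum>j<n. segment_exponent \<pi> i' (\<sigma> j)) = (\<Sum>j<n. segment_exponent \<pi> i' j)"
        using sum.permute[OF \<sigma>, of "segment_exponent \<pi> i'"] by (simp add: comp_def)
      ultimately have "int i = int n * k + int i'"
        using total sum_exponent[OF permutes_id ij(1)] sum_exponent[OF \<pi> i'(1)]
        by (simp add: sum.distrib)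
      moreover from this have "int i mod int n = int i' mod int n"
        by simp
      hence "i = i'"
        using ij(1) i'(1) by simp
      ultimately have "k = 0"
        using ij(1) by simp
      thus ?thesis
        using k[OF ij(2)] \<open>i = i'\<close> by simp
    qed
    \<comment> \<open>The case \<open>i = 0\<close> concerns the common base lattice of the two chains.\<close>
    have units: "v (c j) = 0" if "j < n" for j
      using step[OF \<open>n > 0\<close> that] by (simp add: segment_exponent_def)
    have "\<sigma> ` {..<i} = \<pi> ` {..<i}" if "i < n" for i
    proof (rule card_subset_eq)
      show "\<sigma> ` {..<i} \<subseteq> \<pi> ` {..<i}"
      proof
        fix l assume "l \<in> \<sigma> ` {..<i}"
        then obtain j where "j < i" "l = \<sigma> j"
          by auto
        thus "l \<in> \<pi> ` {..<i}"
          using step[OF that, of j] units[of j] that by (simp add: segment_exponent_def split: if_splits)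
      qed
      show "card (\<sigma> ` {..<i}) = card (\<pi> ` {..<i})"
        using permutes_segment(2)[OF \<sigma>, of i] permutes_segment(2)[OF \<pi>, of i] that by simp
    qed simp
    hence "\<sigma> = \<pi>"
      by (rule permutation_determined_by_initial_segments[OF \<sigma> \<pi>])
    thus ?thesis
      using h g(2) mono by auto
  qed
  thus ?thesis
    using P unfolding realises_all_permutations_def by blast
qed

section \<open>Failure of weak transitivity\<close>

lemma strongly_transitive_imp_weakly_transitive:
  assumes "apartment_system \<Delta> \<A>c \<A>" "strongly_transitive act H \<Delta> \<A>"
  shows "weakly_transitive act H \<A>c"
proof -
  have "\<A> \<subseteq> \<A>c"
    using assms(1) by (simp add: apartment_system_def)
  moreover have "\<exists>\<Sigma>\<in>\<A>. chamber_transitive act (stabilizer act H \<Sigma>) \<Sigma>"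
    using assms(2) by (simp add: strongly_transitive_def)
  ultimately show ?thesis
    unfolding weakly_transitive_def by (meson subsetD)
qed

theorem corollary3p6:
  fixes \<iota>D :: "'f::field \<Rightarrow> 'd::division_ring"
    and \<iota>K :: "'f \<Rightarrow> 'k::field"
    and d :: nat
    and \<Theta> :: "('d \<times> 'k \<Rightarrow>\<^sub>0 int) set \<Rightarrow> 'k mat"
    and H :: "'k mat set"
  assumes "central_division_algebra \<iota>D d"
    and "d > 2"
    and "field_hom \<iota>K"
    and "splitting_iso \<iota>D \<iota>K d \<Theta>"
    and "H = SL1 (splitting_embedding \<iota>D \<iota>K \<Theta>)"
  shows "\<not> weakly_transitive mat_image H (spherical_apartments d) \<and>
    (\<forall>\<A>. apartment_system (spherical_building d) (spherical_apartments d) \<A> \<longrightarrow>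
       \<not> strongly_transitive mat_image H (spherical_building d) \<A>) \<and>
    (\<forall>v :: 'k \<Rightarrow> int. discrete_valuation v \<longrightarrow> val_complete v \<longrightarrow>
       \<not> weakly_transitive class_image H (affine_apartments v d) \<and>
       (\<forall>\<A>. apartment_system (affine_building v d) (affine_apartments v d) \<A> \<longrightarrow>
          \<not> strongly_transitive class_image H (affine_building v d) \<A>))"
proof -
  interpret division_algebra_rep "splitting_embedding \<iota>D \<iota>K \<Theta>" d
    using assms(4) by (rule splitting_embedding_rep)
  have H: "h \<in> carrier_mat d d \<and> det h = 1" if "h \<in> H" for h
    using that assms(5) by (auto simp: SL1_def)
  have never: "\<not> realises_all_permutations d H"
    using SL1_not_realises_all_permutations assms(2,5) by simp
  have spherical: "\<not> weakly_transitive mat_image H (spherical_apartments d)"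
    using spherical_weakly_transitive_realises_all_permutations[of d H] H never assms(2) by fastforce
  have affine: "\<not> weakly_transitive class_image H (affine_apartments v d)"
    if "discrete_valuation v" for v :: "'k \<Rightarrow> int"
    using affine_weakly_transitive_realises_all_permutations[OF _ that H] never assms(2) by fastforce
  show ?thesis
    using spherical affine strongly_transitive_imp_weakly_transitive[of _ _ _ mat_image H]
      strongly_transitive_imp_weakly_transitive[of _ _ _ class_image H]
    by (intro conjI allI impI notI) blast+
qed

end
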